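(* Let $\mathbb{K}$ be a field. For every fixed constant $c>0$ and every fixed polynomial function $P$, there is a polynomial-time algorithm for the following problem. The input consists of two sparse polynomials $F,G\in\mathbb{K}[X]$ of degrees $m+n-1$ and $m$ respectively ($n\ge 1$) and sparsity at most $T$, where $G$ can be written as $$G=G_0-X^kG_1,$$ with $G_0,G_1\in\mathbb{K}[X]$ nonzero, $k-\deg(G_0)\ge c\,n$ (that is, $k-\deg(G_0)=\Omega(n)$), and either $\deg(G_0)$ or $\deg(G_1)$ bounded by $P(T\log(m+n))$ (that is, by a polynomial function of the input size). The algorithm decides whether $G$ divides $F$.
   Context: The sparsity of a polynomial is its number of nonzero terms. Polynomials are given in sparse representation: the list of pairs (exponent, nonzero coefficient), with exponents written in binary. For $F$, $G$ of degrees $m+n-1$ and $m$ and sparsity at most $T$, the input size is $O(T\log(m+n))$, and "polynomial time" means cost $(T\log(m+n))^{O(1)}$, where one counts operations in $\mathbb{K}$ (each at unit cost) and bit operations on exponents. *)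

theory Defs
  imports Complex_Main "HOL-Computational_Algebra.Polynomial" "HOL-Library.Log_Nat"
begin

section \<open>Sparse polynomials\<close>

definition sparsity :: "'a::zero poly \<Rightarrow> nat" where
  "sparsity p = card {i. coeff p i \<noteq> 0}"

text \<open>
  The terms may be listed in any order, but every exponent occurs only once.
\<close>

definition sparse_rep :: "(nat \<times> 'a::comm_monoid_add) list \<Rightarrow> 'a poly \<Rightarrow> bool" where
  "sparse_rep ts p \<longleftrightarrow>
     distinct (map fst ts) \<and> (\<forall>(e, a) \<in> set ts. a \<noteq> 0) \<and>
     p = (\<Sum>(e, a) \<leftarrow> ts. monom a e)"

text \<open>
  The quantity that bounds the size of a sparse input of sparsity at most \<open>T\<close> and degrees
  \<open>m + n - 1\<close> and \<open>m\<close>.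
\<close>

definition input_size :: "nat \<Rightarrow> nat \<Rightarrow> nat \<Rightarrow> real" where
  "input_size T m n = real T * log 2 (real (m + n))"


section \<open>The model of computation\<close>

text \<open>
  Algorithms are programs of a first-order functional language (pure LISP) whose atoms are
  natural numbers and elements of a field. Field operations and field equality tests have unit
  cost. Arithmetic on natural numbers is charged by bit operations: a binary operation costs
  the product of the (incremented) numbers of binary digits of its operands, which is the
  schoolbook bound for multiplication and division and bounds the cost of all the others. Values
  are immutable and hence can be shared, so copying a value and constructing or taking apart a
  pair are pointer operations of constant cost.

  Programs are finite and do not depend on the field; the only field constants are 0 and 1.
  Nothing but the arithmetic and the equality test below gives access to a field element.
\<close>

datatype 'a val = VField 'a | VNum nat | VNil | VPair "'a val" "'a val"

datatype num_op = NAdd | NSub | NMul | NDiv | NMod | NEq | NLess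

datatype field_op = FAdd | FSub | FMul | FDiv

datatype expr =
    Var nat  \<comment> \<open>position in the environment; \<open>LetIn\<close> adds its value at position 0\<close>
  | NumLit nat | FieldZero | FieldOne | MkNil
  | NumOp num_op expr expr
  | FieldOp field_op expr expr
  | FieldEq expr expr
  | MkPair expr expr | Fst expr | Snd expr | IsNil expr
  | Cond expr expr expr
  | LetIn expr expr
  | Call nat "expr list"

text \<open>
  A program is the list of the bodies of its mutually recursive functions. A call evaluates the
  body in the environment consisting of the arguments. Function 0 is the main function.
\<close>

type_synonym program = "expr list"

definition num_bits :: "nat \<Rightarrow> nat" where
  "num_bits x = floorlog 2 x"

text \<open>Subtraction truncates at 0. Evaluation excludes division by 0.\<close>

fun num_op_val :: "num_op \<Rightarrow> nat \<Rightarrow> nat \<Rightarrow> nat" where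
  "num_op_val NAdd x y = x + y"
| "num_op_val NSub x y = x - y"
| "num_op_val NMul x y = x * y"
| "num_op_val NDiv x y = x div y"
| "num_op_val NMod x y = x mod y"
| "num_op_val NEq x y = of_bool (x = y)"
| "num_op_val NLess x y = of_bool (x < y)"

fun field_op_val :: "field_op \<Rightarrow> 'a::field \<Rightarrow> 'a \<Rightarrow> 'a" where
  "field_op_val FAdd x y = x + y"
| "field_op_val FSub x y = x - y"
| "field_op_val FMul x y = x * y"
| "field_op_val FDiv x y = x / y"

text \<open>
  \<open>eval p env e t v\<close>: under the function definitions \<open>p\<close>, evaluating \<open>e\<close> in \<open>env\<close> terminates
  with value \<open>v\<close> at total cost \<open>t\<close>. A failing operation (wrong kind of operand, division by 0,
  unknown variable or function) has no value.
\<close>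

inductive
  eval :: "program \<Rightarrow> 'a::field val list \<Rightarrow> expr \<Rightarrow> nat \<Rightarrow> 'a val \<Rightarrow> bool" and
  evals :: "program \<Rightarrow> 'a::field val list \<Rightarrow> expr list \<Rightarrow> nat \<Rightarrow> 'a val list \<Rightarrow> bool"
  for p :: program
where
  Var: "i < length env \<Longrightarrow> eval p env (Var i) 1 (env ! i)"
| NumLit: "eval p env (NumLit x) (1 + num_bits x) (VNum x)"
| FieldZero: "eval p env FieldZero 1 (VField 0)"
| FieldOne: "eval p env FieldOne 1 (VField 1)"
| MkNil: "eval p env MkNil 1 VNil"
| NumOp: "\<lbrakk>eval p env a s (VNum x); eval p env b t (VNum y);
     f \<in> {NDiv, NMod} \<longrightarrow> y \<noteq> 0\<rbrakk>
    \<Longrightarrow> eval p env (NumOp f a b) (s + t + (1 + num_bits x) * (1 + num_bits y))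
          (VNum (num_op_val f x y))"
| FieldOp: "\<lbrakk>eval p env a s (VField x); eval p env b t (VField y); f = FDiv \<longrightarrow> y \<noteq> 0\<rbrakk>
    \<Longrightarrow> eval p env (FieldOp f a b) (s + t + 1) (VField (field_op_val f x y))"
| FieldEq: "\<lbrakk>eval p env a s (VField x); eval p env b t (VField y)\<rbrakk>
    \<Longrightarrow> eval p env (FieldEq a b) (s + t + 1) (VNum (of_bool (x = y)))"
| MkPair: "\<lbrakk>eval p env a s v; eval p env b t w\<rbrakk>
    \<Longrightarrow> eval p env (MkPair a b) (s + t + 1) (VPair v w)"
| Fst: "eval p env a t (VPair v w) \<Longrightarrow> eval p env (Fst a) (t + 1) v"
| Snd: "eval p env a t (VPair v w) \<Longrightarrow> eval p env (Snd a) (t + 1) w"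
| IsNil: "eval p env a t v \<Longrightarrow> eval p env (IsNil a) (t + 1) (VNum (of_bool (v = VNil)))"
| CondTrue: "\<lbrakk>eval p env a s (VNum x); x \<noteq> 0; eval p env b t v\<rbrakk>
    \<Longrightarrow> eval p env (Cond a b c) (s + t + 1) v"
| CondFalse: "\<lbrakk>eval p env a s (VNum 0); eval p env c t v\<rbrakk>
    \<Longrightarrow> eval p env (Cond a b c) (s + t + 1) v"
| LetIn: "\<lbrakk>eval p env a s v; eval p (v # env) b t w\<rbrakk>
    \<Longrightarrow> eval p env (LetIn a b) (s + t + 1) w"
| Call: "\<lbrakk>evals p env as s vs; f < length p; eval p vs (p ! f) t v\<rbrakk>
    \<Longrightarrow> eval p env (Call f as) (s + t + 1) v"
| EvalsNil: "evals p env [] 0 []"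
| EvalsCons: "\<lbrakk>eval p env a s v; evals p env as t vs\<rbrakk>
    \<Longrightarrow> evals p env (a # as) (s + t) (v # vs)"

definition run :: "program \<Rightarrow> 'a::field val list \<Rightarrow> nat \<Rightarrow> 'a val \<Rightarrow> bool" where
  "run p vs t v \<longleftrightarrow> p \<noteq> [] \<and> eval p vs (p ! 0) t v"

text \<open>The value and the cost of a computation are unique.\<close>

inductive_cases det_elims:
  "eval p env (Var i) t v" "eval p env (NumLit x) t v" "eval p env FieldZero t v"
  "eval p env FieldOne t v" "eval p env MkNil t v" "eval p env (NumOp f a b) t v"
  "eval p env (FieldOp g a b) t v" "eval p env (FieldEq a b) t v" "eval p env (MkPair a b) t v"
  "eval p env (Fst a) t v" "eval p env (Snd a) t v" "eval p env (IsNil a) t v"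
  "eval p env (Cond a b c) t v" "eval p env (LetIn a b) t v" "eval p env (Call h as) t v"
  "evals p env [] t vs" "evals p env (a # as) t vs"

lemma eval_deterministic:
  "eval p env e t v \<Longrightarrow> eval p env e t' v' \<Longrightarrow> t = t' \<and> v = v'"
  "evals p env es t vs \<Longrightarrow> evals p env es t' vs' \<Longrightarrow> t = t' \<and> vs = vs'"
proof (induction arbitrary: t' v' and t' vs' rule: eval_evals.inducts)
  case NumOp
  from NumOp.prems show ?case by (elim det_elims) (auto dest!: NumOp.IH(2,4))
next
  case FieldOp
  from FieldOp.prems show ?case by (elim det_elims) (auto dest!: FieldOp.IH(2,4))
next
  case FieldEq
  from FieldEq.prems show ?case by (elim det_elims) (auto dest!: FieldEq.IH(2,4))
next
  case MkPair
  from MkPair.prems show ?case by (elim det_elims) (auto dest!: MkPair.IH(2,4))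
next
  case Fst
  from Fst.prems show ?case by (elim det_elims) (auto dest!: Fst.IH(2))
next
  case Snd
  from Snd.prems show ?case by (elim det_elims) (auto dest!: Snd.IH(2))
next
  case IsNil
  from IsNil.prems show ?case by (elim det_elims) (auto dest!: IsNil.IH(2))
next
  case CondTrue
  from CondTrue.prems show ?case by (elim det_elims) (use CondTrue.hyps in \<open>auto dest!: CondTrue.IH(2,4)\<close>)
next
  case CondFalse
  from CondFalse.prems show ?case by (elim det_elims) (auto dest!: CondFalse.IH(2,4))
next
  case LetIn
  from LetIn.prems show ?case by (elim det_elims) (auto dest!: LetIn.IH(2,4))
next
  case Call
  from Call.prems show ?case by (elim det_elims) (auto dest!: Call.IH(2,5))
next
  case EvalsCons
  from EvalsCons.prems show ?case by (elim det_elims) (auto dest!: EvalsCons.IH(2,4))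
qed (auto elim: det_elims)

fun encode_terms :: "(nat \<times> 'a) list \<Rightarrow> 'a val" where
  "encode_terms [] = VNil"
| "encode_terms ((e, a) # ts) = VPair (VPair (VNum e) (VField a)) (encode_terms ts)"

end

theory Submission
  imports Defs "HOL-Number_Theory.Cong"
begin

text \<open>
  Split \<open>G = A + B\<close> into its terms below and from some exponent \<open>k\<close>. If the gap \<open>k - degree A\<close>
  exceeds the degree of the quotient, then \<open>F = G * Q\<close> splits at \<open>k\<close> into \<open>F\<^sub>0 = A * Q\<close> and
  \<open>F\<^sub>1 = B * Q\<close>. So \<open>G\<close> divides \<open>F\<close> iff \<open>F\<^sub>0 * B = F\<^sub>1 * A\<close> and \<open>A\<close> divides \<open>F\<^sub>0\<close>; given the
  identity, it is equivalent that \<open>B\<close> divides \<open>F\<^sub>1\<close>. The identity is one between sparse polynomials.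
  Divisibility by the factor of small degree (after removing \<open>X ^ k\<close> from \<open>B\<close>) is tested with
  the powers of \<open>X\<close> modulo it, which repeated squaring computes.

  A gap of only \<open>c * n\<close> is first enlarged: multiplying \<open>F\<close> and \<open>G\<close> by \<open>A - B\<close> keeps the quotient and
  replaces \<open>(A, B, k)\<close> by \<open>(A\<^sup>2, - B\<^sup>2, 2 * k)\<close>, which doubles the gap. A number \<open>r\<close> of rounds with
  \<open>2 ^ r * c \<ge> 1\<close> suffices, and as \<open>r\<close> is constant, sizes grow polynomially.

  The split is not part of the input. Among the exponents \<open>k\<close> of \<open>G\<close> with a large enough gap the
  algorithm takes one that minimises the smaller of the two degrees, hence it does not need to
  know \<open>P\<close> or \<open>T\<close>.
\<close>

section \<open>A cost calculus for programs\<close>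

text \<open>
  In a computation whose numbers stay below \<open>2 ^ W\<close> every primitive operation costs at most
  this much. It is the unit of all cost bounds below.
\<close>

definition op_cost :: "nat \<Rightarrow> nat" where
  "op_cost W = (W + 1)\<^sup>2"

lemma op_cost_pos: "1 \<le> op_cost W"
  by (simp add: op_cost_def)

definition halts :: "program \<Rightarrow> nat \<Rightarrow> 'a::field val list \<Rightarrow> bool" where
  "halts p f vs \<longleftrightarrow> f < length p \<and> (\<exists>t v. eval p vs (p ! f) t v)"

text \<open>By \<open>eval_deterministic\<close> there is at most one candidate, so the description
  is proper whenever the call halts. Value and cost as functions of the arguments let
  \<open>wp\<close> speak of a call without unfolding it.\<close>

definition call_val :: "program \<Rightarrow> nat \<Rightarrow> 'a::field val list \<Rightarrow> 'a val" where
  "call_val p f vs = (THE v. \<exists>t. eval p vs (p ! f) t v)"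

text \<open>The cost in units of \<open>op_cost W\<close>, rounded up; for a call that halts the
  minimum exists because the unit is positive.\<close>

definition call_cost :: "program \<Rightarrow> nat \<Rightarrow> nat \<Rightarrow> 'a::field val list \<Rightarrow> nat" where
  "call_cost p W f vs = (LEAST b. \<exists>t v. eval p vs (p ! f) t v \<and> t \<le> b * op_cost W)"

definition runs :: "program \<Rightarrow> nat \<Rightarrow> nat \<Rightarrow> 'a::field val list \<Rightarrow> 'a val \<Rightarrow> nat \<Rightarrow> bool" where
  "runs p W f vs v b \<longleftrightarrow> halts p f vs \<and> call_val p f vs = v \<and> call_cost p W f vs \<le> b"

text \<open>
  The continuation \<open>Q\<close> receives an upper bound of the cost, in units of \<open>op_cost W\<close>, and the value.
  Calls are not unfolded, so recursive functions can be treated by induction.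
\<close>

fun wp :: "program \<Rightarrow> nat \<Rightarrow> 'a::field val list \<Rightarrow> expr \<Rightarrow> (nat \<Rightarrow> 'a val \<Rightarrow> bool) \<Rightarrow> bool"
  and wps :: "program \<Rightarrow> nat \<Rightarrow> 'a::field val list \<Rightarrow> expr list \<Rightarrow> (nat \<Rightarrow> 'a val list \<Rightarrow> bool) \<Rightarrow> bool"
where
  "wp p W env (Var i) Q = (i < length env \<and> Q 1 (env ! i))"
| "wp p W env (NumLit x) Q = (x < 2 ^ W \<and> Q 1 (VNum x))"
| "wp p W env FieldZero Q = Q 1 (VField 0)"
| "wp p W env FieldOne Q = Q 1 (VField 1)"
| "wp p W env MkNil Q = Q 1 VNil"
| "wp p W env (NumOp f a b) Q = wp p W env a (\<lambda>s v. wp p W env b (\<lambda>t w.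
     case v of VNum x \<Rightarrow> (case w of VNum y \<Rightarrow> x < 2 ^ W \<and> y < 2 ^ W \<and>
       (f \<in> {NDiv, NMod} \<longrightarrow> y \<noteq> 0) \<and> Q (s + t + 1) (VNum (num_op_val f x y)) | _ \<Rightarrow> False)
     | _ \<Rightarrow> False))"
| "wp p W env (FieldOp f a b) Q = wp p W env a (\<lambda>s v. wp p W env b (\<lambda>t w.
     case v of VField x \<Rightarrow> (case w of VField y \<Rightarrow>
       (f = FDiv \<longrightarrow> y \<noteq> 0) \<and> Q (s + t + 1) (VField (field_op_val f x y)) | _ \<Rightarrow> False)
     | _ \<Rightarrow> False))"
| "wp p W env (FieldEq a b) Q = wp p W env a (\<lambda>s v. wp p W env b (\<lambda>t w.
     case v of VField x \<Rightarrow> (case w of VField y \<Rightarrow> Q (s + t + 1) (VNum (of_bool (x = y))) | _ \<Rightarrow> False)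
     | _ \<Rightarrow> False))"
| "wp p W env (MkPair a b) Q = wp p W env a (\<lambda>s v. wp p W env b (\<lambda>t w. Q (s + t + 1) (VPair v w)))"
| "wp p W env (Fst a) Q = wp p W env a (\<lambda>s v. case v of VPair x y \<Rightarrow> Q (s + 1) x | _ \<Rightarrow> False)"
| "wp p W env (Snd a) Q = wp p W env a (\<lambda>s v. case v of VPair x y \<Rightarrow> Q (s + 1) y | _ \<Rightarrow> False)"
| "wp p W env (IsNil a) Q = wp p W env a (\<lambda>s v. Q (s + 1) (VNum (of_bool (v = VNil))))"
| "wp p W env (Cond a b c) Q = wp p W env a (\<lambda>s v. case v of VNum x \<Rightarrow>
     (if x \<noteq> 0 then wp p W env b (\<lambda>t w. Q (s + t + 1) w) else wp p W env c (\<lambda>t w. Q (s + t + 1) w))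
     | _ \<Rightarrow> False)"
| "wp p W env (LetIn a b) Q = wp p W env a (\<lambda>s v. wp p W (v # env) b (\<lambda>t w. Q (s + t + 1) w))"
| "wp p W env (Call f as) Q = wps p W env as (\<lambda>s vs. halts p f vs \<and>
     Q (s + call_cost p W f vs + 1) (call_val p f vs))"
| "wps p W env [] Q = Q 0 []"
| "wps p W env (a # as) Q = wp p W env a (\<lambda>s v. wps p W env as (\<lambda>t vs. Q (s + t) (v # vs)))"

text \<open>Keeps the simplifier from rewriting a continuation before it receives its arguments.\<close>

lemma wp_cong [cong]: "env = env' \<Longrightarrow> e = e' \<Longrightarrow> wp p W env e Q = wp p W env' e' Q"
  by simp

lemma wps_cong [cong]: "env = env' \<Longrightarrow> es = es' \<Longrightarrow> wps p W env es Q = wps p W env' es' Q"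
  by simp

lemma halts_eval:
  assumes "halts p f vs"
  obtains t where "f < length p" "eval p vs (p ! f) t (call_val p f vs)"
    "t \<le> call_cost p W f vs * op_cost W"
proof -
  from assms obtain t v where f: "f < length p" and tv: "eval p vs (p ! f) t v"
    by (auto simp: halts_def)
  have v: "call_val p f vs = v"
    unfolding call_val_def by (rule the_equality) (use tv eval_deterministic(1) in blast)+
  have "\<exists>b t v. eval p vs (p ! f) t v \<and> t \<le> b * op_cost W"
    using tv op_cost_pos[of W] by (intro exI[of _ t] exI[of _ v]) simp
  then have "\<exists>t v. eval p vs (p ! f) t v \<and> t \<le> call_cost p W f vs * op_cost W"
    unfolding call_cost_def by (rule LeastI_ex)
  then have "t \<le> call_cost p W f vs * op_cost W"
    using eval_deterministic(1)[OF tv] by blast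
  with f tv v that show thesis by blast
qed

lemma num_bits_le: "x < 2 ^ W \<Longrightarrow> num_bits x \<le> W"
  unfolding num_bits_def by (simp add: floorlog_le_iff)

text \<open>The induction follows the recursion of \<open>wp\<close>. Each rule of
  \<open>eval\<close> adds at most one unit to the cost of its premises, and the side conditions in
  \<open>wp\<close> make the rule applicable and keep its numbers short.\<close>

lemma wp_sound:
  "wp p W env e Q \<Longrightarrow> \<exists>t b v. eval p env e t v \<and> t \<le> b * op_cost W \<and> Q b v"
  "wps p W env es R \<Longrightarrow> \<exists>t b vs. evals p env es t vs \<and> t \<le> b * op_cost W \<and> R b vs"
proof (induction p W env e Q and p W env es R rule: wp_wps.induct)
  case (1 p W env i Q)
  then show ?case
    using op_cost_pos[of W] by (auto intro!: exI[of _ "1::nat"] eval_evals.Var)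
next
  case (2 p W env x Q)
  have "1 + num_bits x \<le> 1 * op_cost W"
    using num_bits_le[of x W] 2 by (auto simp: op_cost_def power2_eq_square)
  then show ?case
    using 2 by (intro exI conjI) (rule eval_evals.NumLit, auto)
next
  case (3 p W env Q)
  then show ?case
    using op_cost_pos[of W] by (auto intro!: exI[of _ "1::nat"] eval_evals.FieldZero)
next
  case (4 p W env Q)
  then show ?case
    using op_cost_pos[of W] by (auto intro!: exI[of _ "1::nat"] eval_evals.FieldOne)
next
  case (5 p W env Q)
  then show ?case
    using op_cost_pos[of W] by (auto intro!: exI[of _ "1::nat"] eval_evals.MkNil)
next
  case (6 p W env f a b Q)
  from "6.IH"(2)[OF "6.prems"[unfolded wp.simps]] obtain s s' v where
    s: "eval p env a s v" "s \<le> s' * op_cost W" and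
    b: "wp p W env b (\<lambda>t w. case v of VNum x \<Rightarrow> (case w of VNum y \<Rightarrow> x < 2 ^ W \<and> y < 2 ^ W \<and>
       (f \<in> {NDiv, NMod} \<longrightarrow> y \<noteq> 0) \<and> Q (s' + t + 1) (VNum (num_op_val f x y)) | _ \<Rightarrow> False)
     | _ \<Rightarrow> False)" by blast
  from "6.IH"(1)[OF b] obtain t t' w where t: "eval p env b t w" "t \<le> t' * op_cost W" and
    r: "case v of VNum x \<Rightarrow> (case w of VNum y \<Rightarrow> x < 2 ^ W \<and> y < 2 ^ W \<and>
       (f \<in> {NDiv, NMod} \<longrightarrow> y \<noteq> 0) \<and> Q (s' + t' + 1) (VNum (num_op_val f x y)) | _ \<Rightarrow> False)
     | _ \<Rightarrow> False" by blast
  from r obtain x y where xy: "v = VNum x" "w = VNum y" "x < 2 ^ W" "y < 2 ^ W"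
    "f \<in> {NDiv, NMod} \<longrightarrow> y \<noteq> 0" "Q (s' + t' + 1) (VNum (num_op_val f x y))"
    by (auto split: val.splits)
  \<comment> \<open>Operands below \<open>2 ^ W\<close> have at most \<open>W\<close> digits; the
    square in \<open>op_cost\<close> comes from this charge.\<close>
  have "(1 + num_bits x) * (1 + num_bits y) \<le> op_cost W"
    using mult_mono[of "1 + num_bits x" "1 + W" "1 + num_bits y" "1 + W"] num_bits_le xy(3,4)
    by (simp add: op_cost_def power2_eq_square)
  then have "s + t + (1 + num_bits x) * (1 + num_bits y) \<le> (s' + t' + 1) * op_cost W"
    using s(2) t(2) by (simp add: add_mult_distrib)
  with xy s(1) t(1) show ?case
    by (intro exI conjI) (rule eval_evals.NumOp, auto)
next
  case (7 p W env f a b Q)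
  from "7.IH"(2)[OF "7.prems"[unfolded wp.simps]] obtain s s' v where
    s: "eval p env a s v" "s \<le> s' * op_cost W" and
    b: "wp p W env b (\<lambda>t w. case v of VField x \<Rightarrow> (case w of VField y \<Rightarrow>
       (f = FDiv \<longrightarrow> y \<noteq> 0) \<and> Q (s' + t + 1) (VField (field_op_val f x y)) | _ \<Rightarrow> False)
     | _ \<Rightarrow> False)" by blast
  from "7.IH"(1)[OF b] obtain t t' w where t: "eval p env b t w" "t \<le> t' * op_cost W" and
    r: "case v of VField x \<Rightarrow> (case w of VField y \<Rightarrow>
       (f = FDiv \<longrightarrow> y \<noteq> 0) \<and> Q (s' + t' + 1) (VField (field_op_val f x y)) | _ \<Rightarrow> False)
     | _ \<Rightarrow> False" by blast
  from r obtain x y where xy: "v = VField x" "w = VField y"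
    "f = FDiv \<longrightarrow> y \<noteq> 0" "Q (s' + t' + 1) (VField (field_op_val f x y))"
    by (auto split: val.splits)
  have "s + t + 1 \<le> (s' + t' + 1) * op_cost W"
    using s(2) t(2) op_cost_pos[of W] by (simp add: add_mult_distrib)
  with xy s(1) t(1) show ?case
    by (intro exI conjI) (rule eval_evals.FieldOp, auto)
next
  case (8 p W env a b Q)
  from "8.IH"(2)[OF "8.prems"[unfolded wp.simps]] obtain s s' v where
    s: "eval p env a s v" "s \<le> s' * op_cost W" and
    b: "wp p W env b (\<lambda>t w. case v of VField x \<Rightarrow> (case w of VField y \<Rightarrow>
        Q (s' + t + 1) (VNum (of_bool (x = y))) | _ \<Rightarrow> False) | _ \<Rightarrow> False)" by blast
  from "8.IH"(1)[OF b] obtain t t' w where t: "eval p env b t w" "t \<le> t' * op_cost W" and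
    r: "case v of VField x \<Rightarrow> (case w of VField y \<Rightarrow>
        Q (s' + t' + 1) (VNum (of_bool (x = y))) | _ \<Rightarrow> False) | _ \<Rightarrow> False" by blast
  from r obtain x y where xy: "v = VField x" "w = VField y"
    "Q (s' + t' + 1) (VNum (of_bool (x = y)))"
    by (auto split: val.splits)
  have "s + t + 1 \<le> (s' + t' + 1) * op_cost W"
    using s(2) t(2) op_cost_pos[of W] by (simp add: add_mult_distrib)
  with xy s(1) t(1) show ?case
    by (intro exI conjI) (rule eval_evals.FieldEq, auto)
next
  case (9 p W env a b Q)
  from "9.IH"(2)[OF "9.prems"[unfolded wp.simps]] obtain s s' v where
    s: "eval p env a s v" "s \<le> s' * op_cost W" and
    b: "wp p W env b (\<lambda>t w. Q (s' + t + 1) (VPair v w))" by blast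
  from "9.IH"(1)[OF b] obtain t t' w where t: "eval p env b t w" "t \<le> t' * op_cost W" and
    r: "Q (s' + t' + 1) (VPair v w)" by blast
  have "s + t + 1 \<le> (s' + t' + 1) * op_cost W"
    using s(2) t(2) op_cost_pos[of W] by (simp add: add_mult_distrib)
  with r s(1) t(1) show ?case
    by (intro exI conjI) (rule eval_evals.MkPair, auto)
next
  case (10 p W env a Q)
  from "10.IH"[OF "10.prems"[unfolded wp.simps]] obtain s s' v where
    s: "eval p env a s v" "s \<le> s' * op_cost W" and
    r: "case v of VPair x y \<Rightarrow> Q (s' + 1) x | _ \<Rightarrow> False" by blast
  from r obtain x y where xy: "v = VPair x y" "Q (s' + 1) x"
    by (auto split: val.splits)
  have "s + 1 \<le> (s' + 1) * op_cost W"
    using s(2) op_cost_pos[of W] by (simp add: add_mult_distrib)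
  with xy s(1) show ?case
    by (intro exI conjI) (rule eval_evals.Fst, auto)
next
  case (11 p W env a Q)
  from "11.IH"[OF "11.prems"[unfolded wp.simps]] obtain s s' v where
    s: "eval p env a s v" "s \<le> s' * op_cost W" and
    r: "case v of VPair x y \<Rightarrow> Q (s' + 1) y | _ \<Rightarrow> False" by blast
  from r obtain x y where xy: "v = VPair x y" "Q (s' + 1) y"
    by (auto split: val.splits)
  have "s + 1 \<le> (s' + 1) * op_cost W"
    using s(2) op_cost_pos[of W] by (simp add: add_mult_distrib)
  with xy s(1) show ?case
    by (intro exI conjI) (rule eval_evals.Snd, auto)
next
  case (12 p W env a Q)
  from "12.IH"[OF "12.prems"[unfolded wp.simps]] obtain s s' v where
    s: "eval p env a s v" "s \<le> s' * op_cost W" and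
    r: "Q (s' + 1) (VNum (of_bool (v = VNil)))" by blast
  have "s + 1 \<le> (s' + 1) * op_cost W"
    using s(2) op_cost_pos[of W] by (simp add: add_mult_distrib)
  with r s(1) show ?case
    by (intro exI conjI) (rule eval_evals.IsNil, auto)
next
  case (13 p W env a b c Q)
  from "13.IH"(3)[OF "13.prems"[unfolded wp.simps]] obtain s s' v where
    s: "eval p env a s v" "s \<le> s' * op_cost W" and
    r: "case v of VNum x \<Rightarrow> (if x \<noteq> 0 then wp p W env b (\<lambda>t w. Q (s' + t + 1) w)
      else wp p W env c (\<lambda>t w. Q (s' + t + 1) w)) | _ \<Rightarrow> False" by blast
  from r obtain x where x: "v = VNum x" by (auto split: val.splits)
  show ?case
  proof (cases "x = 0")
    case False
    then have b: "wp p W env b (\<lambda>t w. Q (s' + t + 1) w)" using r x by simp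
    from "13.IH"(1)[OF False b] obtain t t' w where
      t: "eval p env b t w" "t \<le> t' * op_cost W" "Q (s' + t' + 1) w" by blast
    have "s + t + 1 \<le> (s' + t' + 1) * op_cost W"
      using s(2) t(2) op_cost_pos[of W] by (simp add: add_mult_distrib)
    with t s(1) x False show ?thesis
      by (intro exI conjI) (rule eval_evals.CondTrue, auto)
  next
    case True
    then have b: "wp p W env c (\<lambda>t w. Q (s' + t + 1) w)" using r x by simp
    from "13.IH"(2)[OF _ b] True obtain t t' w where
      t: "eval p env c t w" "t \<le> t' * op_cost W" "Q (s' + t' + 1) w" by blast
    have "s + t + 1 \<le> (s' + t' + 1) * op_cost W"
      using s(2) t(2) op_cost_pos[of W] by (simp add: add_mult_distrib)
    with t s(1) x True show ?thesis
      by (intro exI conjI) (rule eval_evals.CondFalse, auto)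
  qed
next
  case (14 p W env a b Q)
  from "14.IH"(2)[OF "14.prems"[unfolded wp.simps]] obtain s s' v where
    s: "eval p env a s v" "s \<le> s' * op_cost W" and
    b: "wp p W (v # env) b (\<lambda>t w. Q (s' + t + 1) w)" by blast
  from "14.IH"(1)[OF b] obtain t t' w where t: "eval p (v # env) b t w" "t \<le> t' * op_cost W" and
    r: "Q (s' + t' + 1) w" by blast
  have "s + t + 1 \<le> (s' + t' + 1) * op_cost W"
    using s(2) t(2) op_cost_pos[of W] by (simp add: add_mult_distrib)
  with r s(1) t(1) show ?case
    by (intro exI conjI) (rule eval_evals.LetIn, auto)
next
  case (15 p W env f as Q)
  from "15.IH"[OF "15.prems"[unfolded wp.simps]] obtain s s' vs where
    s: "evals p env as s vs" "s \<le> s' * op_cost W" and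
    h: "halts p f vs" and r: "Q (s' + call_cost p W f vs + 1) (call_val p f vs)" by blast
  from halts_eval[OF h, of W] obtain t where t: "f < length p" "eval p vs (p ! f) t
      (call_val p f vs)"
    "t \<le> call_cost p W f vs * op_cost W" by blast
  have "s + t + 1 \<le> (s' + call_cost p W f vs + 1) * op_cost W"
    using s(2) t(3) op_cost_pos[of W] by (simp add: add_mult_distrib)
  with r s(1) t show ?case
    by (intro exI conjI) (rule eval_evals.Call, auto)
next
  case (16 p W env Q)
  then show ?case by (auto intro: eval_evals.EvalsNil)
next
  case (17 p W env a as Q)
  from "17.IH"(2)[OF "17.prems"[unfolded wps.simps]] obtain s s' v where
    s: "eval p env a s v" "s \<le> s' * op_cost W" and
    b: "wps p W env as (\<lambda>t vs. Q (s' + t) (v # vs))" by blast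
  from "17.IH"(1)[OF b] obtain t t' vs where t: "evals p env as t vs" "t \<le> t' * op_cost W" and
    r: "Q (s' + t') (v # vs)" by blast
  have "s + t \<le> (s' + t') * op_cost W"
    using s(2) t(2) by (simp add: add_mult_distrib)
  with r s(1) t(1) show ?case
    by (intro exI conjI) (rule eval_evals.EvalsCons, auto)
qed

text \<open>The rule by which every function is verified: once \<open>wp\<close> has been simplified
  along the body, value and cost are read off from the arguments of the continuation.\<close>

lemma runsI:
  assumes "f < length p" "wp p W vs (p ! f) (\<lambda>b' v'. v' = v \<and> b' \<le> b)"
  shows "runs p W f vs v b"
proof -
  from wp_sound(1)[OF assms(2)] obtain t b' where
    t: "eval p vs (p ! f) t v" "t \<le> b' * op_cost W" "b' \<le> b" by blast
  have "call_val p f vs = v"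
    unfolding call_val_def by (rule the_equality) (use t eval_deterministic(1) in blast)+
  moreover have "call_cost p W f vs \<le> b'"
    unfolding call_cost_def by (rule Least_le) (use t in blast)
  ultimately show ?thesis
    using t assms(1) by (auto simp: runs_def halts_def)
qed

lemma runs_run:
  assumes "runs p W 0 vs v b"
  shows "\<exists>t. run p vs t v \<and> t \<le> b * op_cost W"
proof -
  from assms have "halts p 0 vs" by (simp add: runs_def)
  from halts_eval[OF this, of W] obtain t where "0 < length p" "eval p vs (p ! 0) t v"
    "t \<le> call_cost p W 0 vs * op_cost W" using assms by (auto simp: runs_def)
  moreover have "call_cost p W 0 vs * op_cost W \<le> b * op_cost W"
    using assms by (simp add: runs_def)
  ultimately show ?thesis unfolding run_def using le_trans by blast
qed

text \<open>The form in which the \<open>Call\<close> clause of \<open>wp\<close> uses a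
  specification: the first two facts rewrite the call, the third enters the linear arithmetic on
  costs.\<close>

lemma runsD:
  assumes "runs p W f vs v b"
  shows "halts p f vs" "call_val p f vs = v" "call_cost p W f vs \<le> b"
  using assms by (auto simp: runs_def)

section \<open>The program\<close>

fun encode_coeffs :: "'a list \<Rightarrow> 'a val" where
  "encode_coeffs [] = VNil"
| "encode_coeffs (a # u) = VPair (VField a) (encode_coeffs u)"

text \<open>
  The meaning of the variables of a body is given by the argument list in the corresponding lemma
  \<open>runs_...\<close>, for instance \<open>[e, a, L, acc]\<close> for \<open>mul_term_body\<close>. Index 1 is written \<open>Suc 0\<close>
  because the simplifier rewrites \<open>1 :: nat\<close> to it.
\<close>

abbreviation MAIN_FUN :: nat where "MAIN_FUN \<equiv> 0"
abbreviation MUL_TERM_FUN :: nat where "MUL_TERM_FUN \<equiv> Suc 0"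
abbreviation MUL_TERMS_FUN :: nat where "MUL_TERMS_FUN \<equiv> 2"
abbreviation COEFF_FUN :: nat where "COEFF_FUN \<equiv> 3"
abbreviation VANISH_FUN :: nat where "VANISH_FUN \<equiv> 4"
abbreviation FILTER_FUN :: nat where "FILTER_FUN \<equiv> 5"
abbreviation MAX_EXP_FUN :: nat where "MAX_EXP_FUN \<equiv> 6"
abbreviation SCORE_FUN :: nat where "SCORE_FUN \<equiv> 7"
abbreviation BEST_SPLIT_FUN :: nat where "BEST_SPLIT_FUN \<equiv> 8"
abbreviation SHIFT_SUB_FUN :: nat where "SHIFT_SUB_FUN \<equiv> 9"
abbreviation SHIFT_MOD_FUN :: nat where "SHIFT_MOD_FUN \<equiv> 10"
abbreviation ADD_SCALED_FUN :: nat where "ADD_SCALED_FUN \<equiv> 11"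
abbreviation MUL_MOD_FUN :: nat where "MUL_MOD_FUN \<equiv> 12"
abbreviation POWER_MOD_FUN :: nat where "POWER_MOD_FUN \<equiv> 13"
abbreviation TERMS_MOD_FUN :: nat where "TERMS_MOD_FUN \<equiv> 14"
abbreviation DENSE_COEFFS_FUN :: nat where "DENSE_COEFFS_FUN \<equiv> 15"
abbreviation ALL_ZERO_FUN :: nat where "ALL_ZERO_FUN \<equiv> 16"
abbreviation DENSE_DIVIDES_FUN :: nat where "DENSE_DIVIDES_FUN \<equiv> 17"
abbreviation SPLIT_TEST_FUN :: nat where "SPLIT_TEST_FUN \<equiv> 18"
abbreviation GAP_LOOP_FUN :: nat where "GAP_LOOP_FUN \<equiv> 19"

text \<open>The bindings are the degree \<open>d\<close> of \<open>G\<close>, the number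
  \<open>n = degree F + 1 - d\<close>, the chosen split and the low part of \<open>G\<close>. The
  number \<open>r\<close> of rounds is a literal of the program, as it depends on \<open>c\<close>
  only.\<close>

definition main_body :: "nat \<Rightarrow> expr" where
  "main_body r =
    LetIn (Call MAX_EXP_FUN [Var 1])
   (LetIn (NumOp NSub (NumOp NAdd (Call MAX_EXP_FUN [Var 1]) (NumLit 1)) (Var 0))
   (LetIn (Call BEST_SPLIT_FUN [Var 3, Fst (Fst (Var 3)), Var 3, Var 0, Var 1])
   (LetIn (Call FILTER_FUN [NumLit 1, Var 0, Var 4])
     (Call GAP_LOOP_FUN [NumLit r, Var 4, Var 0, Call FILTER_FUN [NumLit 0, Var 1, Var 5], Var 1,
        Call MAX_EXP_FUN [Var 0], NumOp NSub (Var 3) (Var 1)]))))"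

definition mul_term_body :: "expr" where
  "mul_term_body =
    Cond (IsNil (Var 2)) (Var 3)
      (MkPair (MkPair (NumOp NAdd (Var 0) (Fst (Fst (Var 2)))) (FieldOp FMul (Var 1) (Snd (Fst
          (Var 2)))))
        (Call MUL_TERM_FUN [Var 0, Var 1, Snd (Var 2), Var 3]))"

definition mul_terms_body :: "expr" where
  "mul_terms_body =
    Cond (IsNil (Var 0)) MkNil
      (Call MUL_TERM_FUN [Fst (Fst (Var 0)), Snd (Fst (Var 0)), Var 1, Call MUL_TERMS_FUN [Snd
          (Var 0), Var 1]])"

text \<open>Products of term lists are not normalised, so an exponent may occur repeatedly and its
  coefficients have to be added up.\<close>

definition coeff_body :: "expr" where
  "coeff_body =
    Cond (IsNil (Var 0)) FieldZero
      (LetIn (Call COEFF_FUN [Snd (Var 0), Var 1])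
        (Cond (NumOp NEq (Fst (Fst (Var 1))) (Var 2)) (FieldOp FAdd (Snd (Fst (Var 1))) (Var 0))
            (Var 0)))"

definition vanish_body :: "expr" where
  "vanish_body =
    Cond (IsNil (Var 0)) (NumLit 1)
      (Cond (FieldEq (Call COEFF_FUN [Var 1, Fst (Fst (Var 0))]) FieldZero) (Call VANISH_FUN [Snd
          (Var 0), Var 1]) (NumLit 0))"

definition filter_body :: "expr" where
  "filter_body =
    Cond (IsNil (Var 2)) MkNil
      (LetIn (Call FILTER_FUN [Var 0, Var 1, Snd (Var 2)])
        (Cond (NumOp NEq (Var 1) (NumOp NLess (Fst (Fst (Var 3))) (Var 2))) (MkPair (Fst (Var 3))
            (Var 0)) (Var 0)))"

definition max_exp_body :: "expr" where
  "max_exp_body =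
    Cond (IsNil (Var 0)) (NumLit 0)
      (LetIn (Call MAX_EXP_FUN [Snd (Var 0)])
        (Cond (NumOp NLess (Var 0) (Fst (Fst (Var 1)))) (Fst (Fst (Var 1))) (Var 0)))"

text \<open>The gap is compared after scaling by \<open>2 ^ r\<close>, the factor by which the gap
  loop enlarges it; this replaces the real constant \<open>c\<close> by integer arithmetic.\<close>

definition score_body :: "nat \<Rightarrow> expr" where
  "score_body r =
    LetIn (Call FILTER_FUN [NumLit 1, Var 0, Var 1])
      (Cond (IsNil (Var 0)) (NumOp NAdd (Var 4) (NumLit 1))
        (LetIn (Call MAX_EXP_FUN [Var 0])
          (Cond (NumOp NLess (NumOp NMul (NumOp NSub (Var 2) (Var 0)) (NumLit (2 ^ r))) (Var 4))
            (NumOp NAdd (Var 5) (NumLit 1))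
            (Cond (NumOp NLess (Var 0) (NumOp NSub (Var 5) (Var 2))) (Var 0) (NumOp NSub (Var 5)
                (Var 2))))))"

definition best_split_body :: "expr" where
  "best_split_body =
    Cond (IsNil (Var 0)) (Var 1)
      (Call BEST_SPLIT_FUN [Snd (Var 0),
        Cond (NumOp NLess (Call SCORE_FUN [Fst (Fst (Var 0)), Var 2, Var 3, Var 4])
            (Call SCORE_FUN [Var 1, Var 2, Var 3, Var 4]))
          (Fst (Fst (Var 0))) (Var 1), Var 2, Var 3, Var 4])"

definition shift_sub_body :: "expr" where
  "shift_sub_body =
    Cond (IsNil (Var 2)) MkNil
      (Cond (IsNil (Var 0)) (MkPair (FieldOp FSub (Var 1) (FieldOp FMul (Var 3) (Fst (Var 2))))
          MkNil)
        (MkPair (FieldOp FSub (Fst (Var 0)) (FieldOp FMul (Var 3) (Fst (Var 2))))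
          (Call SHIFT_SUB_FUN [Snd (Var 0), Var 1, Snd (Var 2), Var 3])))"

definition shift_mod_body :: "expr" where
  "shift_mod_body =
    Cond (IsNil (Var 0)) (Var 0)
      (Call SHIFT_SUB_FUN [Snd (Var 0), Var 1, Snd (Var 2), FieldOp FDiv (Fst (Var 0)) (Fst
          (Var 2))])"

definition add_scaled_body :: "expr" where
  "add_scaled_body =
    Cond (IsNil (Var 0)) MkNil
      (MkPair (FieldOp FAdd (Fst (Var 0)) (FieldOp FMul (Var 1) (Fst (Var 2))))
        (Call ADD_SCALED_FUN [Snd (Var 0), Var 1, Snd (Var 2)]))"

definition mul_mod_body :: "expr" where
  "mul_mod_body =
    Cond (IsNil (Var 1)) (Var 0)
      (Call MUL_MOD_FUN [Call ADD_SCALED_FUN [Call SHIFT_MOD_FUN [Var 0, FieldZero, Var 3], Fst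
          (Var 1), Var 2], Snd (Var 1), Var 2, Var 3])"

definition power_mod_body :: "expr" where
  "power_mod_body =
    Cond (Var 0)
      (LetIn (Call POWER_MOD_FUN [NumOp NDiv (Var 0) (NumLit 2), Var 1, Var 2])
        (LetIn (Call MUL_MOD_FUN [Var 3, Var 0, Var 0, Var 2])
          (Cond (NumOp NMod (Var 2) (NumLit 2)) (Call SHIFT_MOD_FUN [Var 0, FieldZero, Var 3])
              (Var 0))))
      (Call SHIFT_MOD_FUN [Var 2, FieldOne, Var 1])"

definition terms_mod_body :: "expr" where
  "terms_mod_body =
    Cond (IsNil (Var 0)) (Var 3)
      (Call ADD_SCALED_FUN [Call TERMS_MOD_FUN [Snd (Var 0), Var 1, Var 2, Var 3], Snd (Fst
          (Var 0)),
        Call POWER_MOD_FUN [NumOp NSub (Fst (Fst (Var 0))) (Var 1), Var 2, Var 3]])"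

definition dense_coeffs_body :: "expr" where
  "dense_coeffs_body =
    MkPair (Call COEFF_FUN [Var 0, NumOp NAdd (Var 1) (Var 2)])
      (Cond (Var 2) (Call DENSE_COEFFS_FUN [Var 0, Var 1, NumOp NSub (Var 2) (NumLit 1)]) MkNil)"

definition all_zero_body :: "expr" where
  "all_zero_body =
    Cond (IsNil (Var 0)) (NumLit 1)
      (Cond (FieldEq (Fst (Var 0)) FieldZero) (Call ALL_ZERO_FUN [Snd (Var 0)]) (NumLit 0))"

text \<open>The empty term list yields \<open>D + 1\<close> zeros; their tail is the zero residue of
  length \<open>D\<close>.\<close>

definition dense_divides_body :: "expr" where
  "dense_divides_body =
    Call ALL_ZERO_FUN [Call TERMS_MOD_FUN [Var 0, Var 3, Call DENSE_COEFFS_FUN [Var 1, Var 3,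
        Var 2], Snd (Call DENSE_COEFFS_FUN [MkNil, Var 3, Var 2])]]"

definition split_test_body :: "expr" where
  "split_test_body =
    LetIn (Call FILTER_FUN [NumLit 1, Var 3, Var 0])
      (LetIn (Call FILTER_FUN [NumLit 0, Var 4, Var 1])
        (LetIn (Call MUL_TERM_FUN [NumLit 0, FieldOp FSub FieldZero FieldOne, Call MUL_TERMS_FUN
            [Var 0, Var 3], Call MUL_TERMS_FUN [Var 1, Var 4]])
          (Cond (Call VANISH_FUN [Var 0, Var 0])
            (Cond (NumOp NLess (Var 7) (Var 8)) (Call DENSE_DIVIDES_FUN [Var 2, Var 4, Var 7,
                NumLit 0])
              (Call DENSE_DIVIDES_FUN [Var 1, Var 5, Var 8, Var 6]))
            (NumLit 0))))"

definition gap_loop_body :: "expr" where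
  "gap_loop_body =
    Cond (Var 0)
      (LetIn (FieldOp FSub FieldZero FieldOne)
        (Call GAP_LOOP_FUN [NumOp NSub (Var 1) (NumLit 1),
          Call MUL_TERMS_FUN [Var 2, Call MUL_TERM_FUN [NumLit 0, Var 0, Var 4, Var 3]],
          Call MUL_TERMS_FUN [Var 3, Var 3],
          Call MUL_TERM_FUN [NumLit 0, Var 0, Call MUL_TERMS_FUN [Var 4, Var 4], MkNil],
          NumOp NAdd (Var 5) (Var 5), NumOp NAdd (Var 6) (Var 6), NumOp NAdd (Var 7) (Var 7)]))
      (Call SPLIT_TEST_FUN [Var 1, Var 2, Var 3, Var 4, Var 5, Var 6])"

definition prog :: "nat \<Rightarrow> program" where
  "prog r = [main_body r, mul_term_body, mul_terms_body, coeff_body, vanish_body, filter_body,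
      max_exp_body, score_body r, best_split_body, shift_sub_body, shift_mod_body,
      add_scaled_body, mul_mod_body, power_mod_body, terms_mod_body, dense_coeffs_body,
      all_zero_body, dense_divides_body, split_test_body, gap_loop_body]"

lemma length_prog [simp]: "length (prog r) = 20"
  by (simp add: prog_def)

lemma prog_nth:
  "prog r ! MAIN_FUN = main_body r"
  "prog r ! MUL_TERM_FUN = mul_term_body"
  "prog r ! MUL_TERMS_FUN = mul_terms_body"
  "prog r ! COEFF_FUN = coeff_body"
  "prog r ! VANISH_FUN = vanish_body"
  "prog r ! FILTER_FUN = filter_body"
  "prog r ! MAX_EXP_FUN = max_exp_body"
  "prog r ! SCORE_FUN = score_body r"
  "prog r ! BEST_SPLIT_FUN = best_split_body"
  "prog r ! SHIFT_SUB_FUN = shift_sub_body"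
  "prog r ! SHIFT_MOD_FUN = shift_mod_body"
  "prog r ! ADD_SCALED_FUN = add_scaled_body"
  "prog r ! MUL_MOD_FUN = mul_mod_body"
  "prog r ! POWER_MOD_FUN = power_mod_body"
  "prog r ! TERMS_MOD_FUN = terms_mod_body"
  "prog r ! DENSE_COEFFS_FUN = dense_coeffs_body"
  "prog r ! ALL_ZERO_FUN = all_zero_body"
  "prog r ! DENSE_DIVIDES_FUN = dense_divides_body"
  "prog r ! SPLIT_TEST_FUN = split_test_body"
  "prog r ! GAP_LOOP_FUN = gap_loop_body"
  by (simp_all add: prog_def)

section \<open>Products of term lists\<close>

definition mul_term :: "nat \<Rightarrow> 'a::field \<Rightarrow> (nat \<times> 'a) list \<Rightarrow> (nat \<times> 'a) list \<Rightarrow> (nat \<times> 'a) list" where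
  "mul_term e a L acc = map (\<lambda>(e', a'). (e + e', a * a')) L @ acc"

text \<open>Sums are concatenations and terms of equal exponent are not merged, so lengths are known
  exactly, but the result need not be a sparse representation.\<close>

fun mul_terms :: "(nat \<times> 'a::field) list \<Rightarrow> (nat \<times> 'a) list \<Rightarrow> (nat \<times> 'a) list" where
  "mul_terms [] L = []"
| "mul_terms ((e, a) # K) L = mul_term e a L (mul_terms K L)"

definition exps_lt :: "nat \<Rightarrow> (nat \<times> 'a) list \<Rightarrow> bool" where
  "exps_lt x L \<longleftrightarrow> (\<forall>(e, a) \<in> set L. e < x)"

lemma exps_lt_simps [simp]:
  "exps_lt x []" "exps_lt x (y # L) \<longleftrightarrow> fst y < x \<and> exps_lt x L"
  "exps_lt x (L @ L') \<longleftrightarrow> exps_lt x L \<and> exps_lt x L'"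
  by (auto simp: exps_lt_def)

text \<open>The pattern of the \<open>runs_\<close> lemmas: induction along the recursion if there
  is one, \<open>runsI\<close>, and simplification with the \<open>runsD\<close> facts of the
  callees. The bound \<open>exps_lt (2 ^ W)\<close> keeps operands short; the numeric factors are
  generous counts of primitive steps.\<close>

lemma runs_mul_term:
  assumes "exps_lt (2 ^ W) L" "e < 2 ^ W"
  shows "runs (prog r) W MUL_TERM_FUN [VNum e, VField a, encode_terms L, encode_terms acc]
    (encode_terms (mul_term e a L acc)) (30 * (length L + 1))"
  using assms
proof (induction L)
  case Nil
  show ?case
    by (rule runsI) (simp_all add: prog_nth mul_term_body_def mul_term_def)
next
  case (Cons x L)
  obtain e' a' where x: "x = (e', a')" by fastforce
  note IH = runsD[OF Cons.IH]
  show ?case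
    by (rule runsI) (use Cons.prems IH in \<open>simp_all add: prog_nth mul_term_body_def mul_term_def x\<close>)
qed

lemma runs_mul_terms:
  assumes "exps_lt (2 ^ W) L" "exps_lt (2 ^ W) K"
  shows "runs (prog r) W MUL_TERMS_FUN [encode_terms K, encode_terms L]
    (encode_terms (mul_terms K L)) (30 * (length K + 1) * (length L + 2))"
  using assms(2)
proof (induction K)
  case Nil
  show ?case
    by (rule runsI) (simp_all add: prog_nth mul_terms_body_def)
next
  case (Cons x K)
  obtain e' a' where x: "x = (e', a')" by fastforce
  note IH = runsD[OF Cons.IH]
  note m = runsD[OF runs_mul_term[OF assms(1), where e = e' and a = a' and acc = "mul_terms K L"
      and r = r]]
  show ?case
    by (rule runsI) (use Cons.prems IH m in \<open>simp_all add: prog_nth mul_terms_body_def x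
        algebra_simps\<close>)
qed

section \<open>Term lists and the choice of the split\<close>

definition poly_of :: "(nat \<times> 'a::comm_monoid_add) list \<Rightarrow> 'a poly" where
  "poly_of ts = (\<Sum>(e, a) \<leftarrow> ts. monom a e)"

lemma poly_of_simps [simp]:
  "poly_of [] = 0" "poly_of (y # L) = monom (snd y) (fst y) + poly_of L"
  "poly_of (L @ L') = poly_of L + poly_of L'"
  by (auto simp: poly_of_def split: prod.splits)

lemma Suc_0_less_two_power [simp]: "0 < W \<Longrightarrow> Suc 0 < 2 ^ W"
  using power_strict_increasing[of 0 W "2::nat"] by simp

lemma runs_coeff:
  assumes "exps_lt (2 ^ W) L" "e < 2 ^ W"
  shows "runs (prog r) W COEFF_FUN [encode_terms L, VNum e] (VField (coeff (poly_of L) e)) (30 *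
      (length L + 1))"
  using assms(1)
proof (induction L)
  case Nil
  show ?case
    by (rule runsI) (simp_all add: prog_nth coeff_body_def)
next
  case (Cons x L)
  obtain e' a' where x: "x = (e', a')" by fastforce
  note IH = runsD[OF Cons.IH]
  show ?case
    by (rule runsI) (use Cons.prems IH assms(2) in \<open>simp_all add: prog_nth coeff_body_def x\<close>)
qed

lemma runs_vanish:
  assumes "exps_lt (2 ^ W) K" "exps_lt (2 ^ W) L" "0 < W"
  shows "runs (prog r) W VANISH_FUN [encode_terms K, encode_terms L]
    (VNum (of_bool (\<forall>y \<in> set K. coeff (poly_of L) (fst y) = 0))) (30 * (length K + 1) *
        (length L + 2))"
  using assms(1)
proof (induction K)
  case Nil
  show ?case
    by (rule runsI) (use assms in \<open>simp_all add: prog_nth vanish_body_def\<close>)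
next
  case (Cons x K)
  obtain e' a' where x: "x = (e', a')" by fastforce
  note IH = runsD[OF Cons.IH]
  have "e' < 2 ^ W" using Cons.prems x by simp
  note c = runsD[OF runs_coeff[OF assms(2) this, of r]]
  show ?case
    by (rule runsI) (use Cons.prems IH assms c in \<open>simp_all add: prog_nth vanish_body_def x
        algebra_simps\<close>)
qed

lemma runs_filter:
  assumes "exps_lt (2 ^ W) L" "k < 2 ^ W" "0 < W"
  shows "runs (prog r) W FILTER_FUN [VNum (of_bool b), VNum k, encode_terms L]
    (encode_terms (filter (\<lambda>y. (fst y < k) = b) L)) (30 * (length L + 1))"
  using assms(1)
proof (induction L)
  case Nil
  show ?case
    by (rule runsI) (use assms in \<open>simp_all add: prog_nth filter_body_def\<close>)
next
  case (Cons x L)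
  obtain e' a' where x: "x = (e', a')" by fastforce
  note IH = runsD[OF Cons.IH]
  have b: "of_bool P < (2::nat) ^ W" for P
    using assms(3) by (cases P) auto
  show ?case
    by (rule runsI) (use Cons.prems IH assms b in \<open>simp_all add: prog_nth filter_body_def x\<close>)
qed

definition max_exp :: "(nat \<times> 'a) list \<Rightarrow> nat" where
  "max_exp L = foldr (\<lambda>y. max (fst y)) L 0"

lemma max_exp_simps [simp]: "max_exp [] = 0" "max_exp (y # L) = max (fst y) (max_exp L)"
  by (simp_all add: max_exp_def)

lemma max_exp_lt: "exps_lt x L \<Longrightarrow> 0 < x \<Longrightarrow> max_exp L < x"
  by (induction L) auto

lemma runs_max_exp:
  assumes "exps_lt (2 ^ W) L"
  shows "runs (prog r) W MAX_EXP_FUN [encode_terms L] (VNum (max_exp L)) (30 * (length L + 1))"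
  using assms
proof (induction L)
  case Nil
  show ?case
    by (rule runsI) (simp_all add: prog_nth max_exp_body_def)
next
  case (Cons x L)
  obtain e' a' where x: "x = (e', a')" by fastforce
  note IH = runsD[OF Cons.IH]
  have "max_exp L < 2 ^ W" using Cons.prems max_exp_lt[of "2 ^ W" L] by simp
  then show ?case
    by (intro runsI) (use Cons.prems IH in \<open>simp_all add: prog_nth max_exp_body_def x max_def\<close>)
qed

text \<open>
  \<open>d\<close> is the degree of \<open>G\<close>; the value \<open>d + 1\<close> of a split without a sufficient gap exceeds that of
  every admissible split.
\<close>

definition score :: "nat \<Rightarrow> nat \<Rightarrow> (nat \<times> 'a) list \<Rightarrow> nat \<Rightarrow> nat \<Rightarrow> nat" where
  "score r k G n d = (let A = filter (\<lambda>y. fst y < k) G in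
     if A = [] \<or> (k - max_exp A) * 2 ^ r < n then d + 1 else min (max_exp A) (d - k))"

lemma exps_lt_filter [simp]: "exps_lt x L \<Longrightarrow> exps_lt x (filter P L)"
  by (auto simp: exps_lt_def)

lemma encode_terms_VNil [simp]: "encode_terms L = VNil \<longleftrightarrow> L = []"
  by (cases L) auto

text \<open>Bounding \<open>k * 2 ^ r\<close> controls the scaled gap, and \<open>r < W\<close>
  admits the literal \<open>2 ^ r\<close>.\<close>

lemma runs_score:
  assumes "exps_lt (2 ^ W) G" "0 < W" "k * 2 ^ r < 2 ^ W" "r < W" "n < 2 ^ W" "d < 2 ^ W"
  shows "runs (prog r) W SCORE_FUN [VNum k, encode_terms G, VNum n, VNum d] (VNum (score r k G n d))
    (90 * (length G + 1))"
proof -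
  have k: "k < 2 ^ W"
    using assms(3) by (metis le_square mult_le_mono2 one_le_numeral one_le_power
        order_le_less_trans mult.right_neutral)
  let ?A = "filter (\<lambda>y. fst y < k) G"
  note f = runsD[OF runs_filter[OF assms(1) k assms(2), of r True, simplified]]
  have A: "exps_lt (2 ^ W) ?A" using assms by simp
  note m = runsD[OF runs_max_exp[OF A, of r]]
  have mA: "max_exp ?A < 2 ^ W" using A max_exp_lt by fastforce
  have m3: "call_cost (prog r) W MAX_EXP_FUN [encode_terms ?A] \<le> 30 * (length G + 1)"
    using m(3) by (rule order_trans) simp
  have k2: "(k - max_exp ?A) * 2 ^ r < 2 ^ W"
    using assms(3) by (meson diff_le_self le_less_trans mult_le_mono1)
  show ?thesis
    by (rule runsI) (use assms k f m(1,2) m3 mA k2 in \<open>auto simp: prog_nth score_body_def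
        score_def Let_def less_imp_diff_less\<close>)
qed

fun best_split :: "nat \<Rightarrow> (nat \<times> 'a) list \<Rightarrow> nat \<Rightarrow> (nat \<times> 'a) list \<Rightarrow> nat \<Rightarrow> nat \<Rightarrow> nat" where
  "best_split r [] b G n d = b"
| "best_split r (y # L) b G n d =
     best_split r L (if score r (fst y) G n d < score r b G n d then fst y else b) G n d"

lemma score_le: "score r k G n d \<le> d + 1"
  by (auto simp: score_def Let_def)

lemma runs_best_split:
  assumes "exps_lt (2 ^ W) G" "0 < W" "r < W" "n < 2 ^ W" "d + 1 < 2 ^ W"
    "\<forall>y \<in> set L. fst y * 2 ^ r < 2 ^ W" "b * 2 ^ r < 2 ^ W"
  shows "runs (prog r) W BEST_SPLIT_FUN [encode_terms L, VNum b, encode_terms G, VNum n, VNum d]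
    (VNum (best_split r L b G n d)) (240 * (length L + 1) * (length G + 1))"
  using assms(6,7)
proof (induction L arbitrary: b)
  case Nil
  show ?case
    by (rule runsI) (simp_all add: prog_nth best_split_body_def)
next
  case (Cons x L)
  obtain e' a' where x: "x = (e', a')" by fastforce
  have e: "e' * 2 ^ r < 2 ^ W" "d < 2 ^ W" using Cons.prems assms x by auto
  have sc: "score r k G n d < 2 ^ W" for k
    using score_le[of r k G n d] assms(5) by linarith
  have P: "\<forall>y \<in> set L. fst y * 2 ^ r < 2 ^ W" using Cons.prems by simp
  note IH1 = runsD[OF Cons.IH[OF P e(1)]]
  note IH2 = runsD[OF Cons.IH[OF P Cons.prems(2)]]
  note s1 = runsD[OF runs_score[OF assms(1,2) e(1) assms(3,4) e(2)]]
  note s2 = runsD[OF runs_score[OF assms(1,2) Cons.prems(2) assms(3,4) e(2)]]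
  show ?case
    by (rule runsI) (use IH1 IH2 s1 s2 sc in \<open>simp_all add: prog_nth best_split_body_def x
        algebra_simps\<close>)
qed

section \<open>Arithmetic modulo a dense polynomial\<close>

lemma encode_coeffs_VNil [simp]: "encode_coeffs u = VNil \<longleftrightarrow> u = []"
  by (cases u) auto

text \<open>
  Coefficient lists start with the leading coefficient. If \<open>x\<close> and \<open>c\<close> are the leading coefficients
  removed from the residue and from the modulus, then \<open>b = x / c\<close> yields the residue of \<open>X * u + a\<close>.
\<close>

fun shift_sub :: "'a::field list \<Rightarrow> 'a \<Rightarrow> 'a list \<Rightarrow> 'a \<Rightarrow> 'a list" where
  "shift_sub u a [] b = []"
| "shift_sub [] a (c # v) b = [a - b * c]"
| "shift_sub (x # u) a (c # v) b = (x - b * c) # shift_sub u a v b"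

lemma runs_shift_sub:
  "runs (prog r) W SHIFT_SUB_FUN [encode_coeffs u, VField a, encode_coeffs v, VField b]
      (encode_coeffs (shift_sub u a v b)) (40 * (length v + 1))"
proof (induction v arbitrary: u)
  case Nil
  show ?case
    by (rule runsI) (simp_all add: prog_nth shift_sub_body_def)
next
  case (Cons c v)
  note IH = runsD[OF Cons.IH]
  show ?case
    by (rule runsI; cases u) (use IH[of "tl u"] in \<open>simp_all add: prog_nth shift_sub_body_def\<close>)
qed

text \<open>An empty residue belongs to a constant modulus, modulo which everything is 0, hence it
  stays empty.\<close>

fun shift_mod :: "'a::field list \<Rightarrow> 'a \<Rightarrow> 'a list \<Rightarrow> 'a list" where
  "shift_mod [] a v = []"
| "shift_mod (x # u) a v = shift_sub u a (tl v) (x / hd v)"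

lemma runs_shift_mod:
  assumes "length v = length u + 1" "hd v \<noteq> 0"
  shows "runs (prog r) W SHIFT_MOD_FUN [encode_coeffs u, VField a, encode_coeffs v] (encode_coeffs
      (shift_mod u a v)) (50 * (length u + 1))"
proof -
  obtain c v' where v: "v = c # v'" using assms(1) by (cases v) auto
  note red = runsD[OF runs_shift_sub[of r W "tl u" a v' "hd u / c"]]
  show ?thesis
    by (rule runsI; cases u)
      (use assms red v in \<open>simp_all add: prog_nth shift_mod_body_def\<close>)
qed

fun add_scaled :: "'a::field list \<Rightarrow> 'a \<Rightarrow> 'a list \<Rightarrow> 'a list" where
  "add_scaled [] c v = []"
| "add_scaled (x # u) c v = (x + c * hd v) # add_scaled u c (tl v)"

lemma runs_add_scaled:
  assumes "length u \<le> length v"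
  shows "runs (prog r) W ADD_SCALED_FUN [encode_coeffs u, VField c, encode_coeffs v]
      (encode_coeffs (add_scaled u c v)) (30 * (length u + 1))"
  using assms
proof (induction u arbitrary: v)
  case Nil
  show ?case
    by (rule runsI) (simp_all add: prog_nth add_scaled_body_def)
next
  case (Cons x u)
  then obtain y v' where v: "v = y # v'" by (cases v) auto
  note IH = runsD[OF Cons.IH[of v']]
  show ?case
    by (rule runsI) (use IH Cons.prems in \<open>simp_all add: prog_nth add_scaled_body_def v\<close>)
qed

lemma length_shift_sub [simp]: "length v = length u + 1 \<Longrightarrow> length (shift_sub u a v b) = length v"
  by (induction u a v b rule: shift_sub.induct) auto

lemma length_shift_mod [simp]: "length v = length u + 1 \<Longrightarrow> length (shift_mod u a v) = length u"
  by (cases u) auto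

lemma length_add_scaled [simp]: "length (add_scaled u c v) = length u"
  by (induction u c v rule: add_scaled.induct) auto

text \<open>Horner's rule in the coefficients of the first factor, with a reduction at every shift,
  so that the accumulator keeps its length.\<close>

fun mul_mod :: "'a::field list \<Rightarrow> 'a list \<Rightarrow> 'a list \<Rightarrow> 'a list \<Rightarrow> 'a list" where
  "mul_mod acc [] v b = acc"
| "mul_mod acc (x # u) v b = mul_mod (add_scaled (shift_mod acc 0 b) x v) u v b"

lemma length_mul_mod [simp]:
  "length b = length acc + 1 \<Longrightarrow> length (mul_mod acc u v b) = length acc"
  by (induction acc u v b rule: mul_mod.induct) auto

lemma runs_mul_mod:
  assumes "length acc = D" "length v = D" "length b = D + 1" "hd b \<noteq> 0"
  shows "runs (prog r) W MUL_MOD_FUN [encode_coeffs acc, encode_coeffs u, encode_coeffs v,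
      encode_coeffs b] (encode_coeffs (mul_mod acc u v b))
    (100 * (length u + 1) * (D + 1))"
  using assms(1)
proof (induction u arbitrary: acc)
  case Nil
  show ?case
    by (rule runsI) (simp_all add: prog_nth mul_mod_body_def)
next
  case (Cons x u)
  let ?s = "shift_mod acc 0 b"
  have l: "length ?s = D" using Cons.prems assms by simp
  note IH = runsD[OF Cons.IH[of "add_scaled ?s x v"]]
  note st = runsD[OF runs_shift_mod[of b acc r W 0]]
  note ax = runsD[OF runs_add_scaled[of ?s v r W x]]
  show ?case
    by (rule runsI) (use IH st ax l Cons.prems assms in \<open>simp_all add: prog_nth mul_mod_body_def
        algebra_simps\<close>)
qed

text \<open>Repeated squaring. The zero residue \<open>z\<close> starts every Horner accumulation
  and fixes the length; shifting the coefficient 1 into it yields the residue of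
  \<open>X ^ 0\<close>.\<close>

fun power_mod :: "nat \<Rightarrow> 'a::field list \<Rightarrow> 'a list \<Rightarrow> 'a list" where
  "power_mod e b z = (if e = 0 then shift_mod z 1 b else
     let h = power_mod (e div 2) b z; s = mul_mod z h h b
     in if even e then s else shift_mod s 0 b)"

declare power_mod.simps [simp del]

lemma length_power_mod [simp]: "length b = length z + 1 \<Longrightarrow> length (power_mod e b z) = length z"
proof (induction e b z rule: power_mod.induct)
  case (1 e b z)
  then show ?case by (subst power_mod.simps) (simp add: Let_def)
qed

text \<open>Induction on the bit length \<open>w\<close> of the exponent, which drops by one per
  halving, while \<open>W\<close> stays fixed: there are at most \<open>w + 1\<close> levels, each
  with at most one product, of cost quadratic in \<open>D\<close>.\<close>

lemma runs_power_mod: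
  assumes "length z = D" "length b = D + 1" "hd b \<noteq> 0" "2 \<le> W" "e < 2 ^ w" "w \<le> W"
  shows "runs (prog r) W POWER_MOD_FUN [VNum e, encode_coeffs b, encode_coeffs z] (encode_coeffs
      (power_mod e b z)) (200 * (w + 1) * (D + 1)\<^sup>2)"
  using assms(5,6)
proof (induction w arbitrary: e)
  case 0
  note st = runsD[OF runs_shift_mod[of b z r W 1]]
  have "D \<le> D\<^sup>2" by (simp add: power2_nat_le_imp_le self_le_power)
  then show ?case
    by (intro runsI) (use 0 assms st in \<open>simp_all add: prog_nth power_mod_body_def
        power_mod.simps[of 0] power2_eq_square algebra_simps\<close>)
next
  case (Suc w)
  have e2: "e div 2 < 2 ^ w" "w \<le> W" using Suc.prems by auto
  have eW: "e < 2 ^ W" using Suc.prems by (meson less_le_trans one_le_numeral power_increasing)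
  have 2: "2 < (2::nat) ^ W" using assms(4) power_strict_increasing[of 1 W "2::nat"] by simp
  note IH = runsD[OF Suc.IH[OF e2]]
  let ?h = "power_mod (e div 2) b z"
  let ?s = "mul_mod z ?h ?h b"
  note st1 = runsD[OF runs_shift_mod[of b z r W 1]]
  note st2 = runsD[OF runs_shift_mod[of b ?s r W 0]]
  note mm = runsD[OF runs_mul_mod[of z D ?h b r W ?h]]
  have "D \<le> D * D" by simp
  then show ?case
    by (intro runsI; cases "e = 0"; cases "even e") (use e2 eW 2 assms st1 st2 mm IH in
      \<open>simp_all add: prog_nth power_mod_body_def power_mod.simps[of 0] power_mod.simps[of e]
          power2_eq_square algebra_simps Let_def even_iff_mod_2_eq_zero odd_iff_mod_2_eq_one\<close>)
qed

fun terms_mod :: "(nat \<times> 'a::field) list \<Rightarrow> nat \<Rightarrow> 'a list \<Rightarrow> 'a list \<Rightarrow> 'a list" where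
  "terms_mod [] off b z = z"
| "terms_mod ((e, a) # L) off b z = add_scaled (terms_mod L off b z) a (power_mod (e - off) b z)"

lemma length_terms_mod [simp]: "length (terms_mod L off b z) = length z"
  by (induction L off b z rule: terms_mod.induct) auto

lemma runs_terms_mod:
  assumes "exps_lt (2 ^ W) L" "off < 2 ^ W" "length z = D" "length b = D + 1" "hd b \<noteq> 0" "2 \<le> W"
  shows "runs (prog r) W TERMS_MOD_FUN [encode_terms L, VNum off, encode_coeffs b,
      encode_coeffs z] (encode_coeffs (terms_mod L off b z))
    (20 + 300 * length L * ((W + 1) * (D + 1)\<^sup>2))"
  using assms(1)
proof (induction L)
  case Nil
  show ?case
    by (rule runsI) (simp_all add: prog_nth terms_mod_body_def)
next
  case (Cons x L)
  obtain e a where x: "x = (e, a)" by fastforce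
  define X where "X = (W + 1) * (D + 1)\<^sup>2"
  have e: "e - off < 2 ^ W" using Cons.prems x by (simp add: less_imp_diff_less)
  note IH = runsD[OF Cons.IH, folded X_def]
  note p = runsD[OF runs_power_mod[OF assms(3-6) e order_refl, where r = r]]
  have p3: "call_cost (prog r) W POWER_MOD_FUN [VNum (e - off), encode_coeffs b,
      encode_coeffs z] \<le> 200 * X"
    using p(3) by (simp only: X_def mult.assoc)
  note ax = runsD[OF runs_add_scaled[of "terms_mod L off b z" "power_mod (e - off) b z" r W a]]
  have "1 * (D + 1) \<le> X"
    unfolding X_def by (intro mult_le_mono self_le_power) simp_all
  then show ?case
    unfolding X_def[symmetric]
    by (intro runsI) (use Cons.prems IH p(1,2) p3 ax assms in \<open>simp_all add: prog_nth
        terms_mod_body_def x algebra_simps\<close>)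
qed

text \<open>If \<open>poly_of L\<close> is divisible by \<open>X ^ off\<close> and has degree
  \<open>off + D\<close>, this is the dense form of the quotient, leading coefficient first.\<close>

fun dense_coeffs :: "(nat \<times> 'a::field) list \<Rightarrow> nat \<Rightarrow> nat \<Rightarrow> 'a list" where
  "dense_coeffs L off 0 = [coeff (poly_of L) off]"
| "dense_coeffs L off (Suc D) = coeff (poly_of L) (off + Suc D) # dense_coeffs L off D"

lemma length_dense_coeffs [simp]: "length (dense_coeffs L off D) = D + 1"
  by (induction D) auto

lemma dense_coeffs_Nil: "dense_coeffs [] off D = replicate (Suc D) 0"
  by (induction D) auto

lemma runs_dense_coeffs:
  assumes "exps_lt (2 ^ W) L" "off + D < 2 ^ W" "0 < W"
  shows "runs (prog r) W DENSE_COEFFS_FUN [encode_terms L, VNum off, VNum D] (encode_coeffs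
      (dense_coeffs L off D))
    (60 * (D + 1) * (length L + 1))"
  using assms(2)
proof (induction D)
  case 0
  then have o: "off < 2 ^ W" by simp
  note c = runsD[OF runs_coeff[OF assms(1) o, of r]]
  show ?case
    by (rule runsI) (use 0 c in \<open>simp_all add: prog_nth dense_coeffs_body_def\<close>)
next
  case (Suc D)
  note IH = runsD[OF Suc.IH]
  note c = runsD[OF runs_coeff[OF assms(1) Suc.prems, of r]]
  show ?case
    by (rule runsI) (use Suc.prems IH c assms in \<open>simp_all add: prog_nth dense_coeffs_body_def
        algebra_simps\<close>)
qed

lemma runs_all_zero:
  assumes "0 < W"
  shows "runs (prog r) W ALL_ZERO_FUN [encode_coeffs u] (VNum (of_bool (\<forall>a \<in> set u. a = 0))) (30 *
      (length u + 1))"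
proof (induction u)
  case Nil
  show ?case
    by (rule runsI) (use assms in \<open>simp_all add: prog_nth all_zero_body_def\<close>)
next
  case (Cons a u)
  note IH = runsD[OF Cons.IH]
  show ?case
    by (rule runsI) (use IH assms in \<open>simp_all add: prog_nth all_zero_body_def\<close>)
qed

text \<open>Both polynomials are taken without their factor \<open>X ^ off\<close>:
  \<open>terms_mod\<close> lowers the exponents of \<open>F\<close>, and \<open>dense_coeffs\<close>
  starts the modulus at \<open>off\<close>.\<close>

definition dense_divides :: "(nat \<times> 'a::field) list \<Rightarrow> (nat \<times> 'a) list \<Rightarrow> nat \<Rightarrow> nat \<Rightarrow> bool" where
  "dense_divides F L D off \<longleftrightarrow> (\<forall>a \<in> set (terms_mod F off (dense_coeffs L off D)
      (replicate D 0)). a = 0)"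

lemma hd_dense_coeffs: "hd (dense_coeffs L off D) = coeff (poly_of L) (off + D)"
  by (cases D) auto

lemma runs_dense_divides:
  assumes "exps_lt (2 ^ W) F" "exps_lt (2 ^ W) L" "off + D < 2 ^ W" "2 \<le> W"
    "coeff (poly_of L) (off + D) \<noteq> 0"
    "length F \<le> N" "length L \<le> N" "W \<le> N" "D \<le> N"
  shows "runs (prog r) W DENSE_DIVIDES_FUN [encode_terms F, encode_terms L, VNum D, VNum off]
    (VNum (of_bool (dense_divides F L D off))) (1000 * (N + 1) ^ 4)"
proof -
  define b where "b = dense_coeffs L off D"
  define z :: "'a list" where "z = replicate D 0"
  have o: "off < 2 ^ W" and W: "0 < W" using assms by auto
  note d1 = runsD[OF runs_dense_coeffs[OF assms(2,3) W, of r]]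
  note d2 = runsD[OF runs_dense_coeffs[where L = "[] :: (nat \<times> 'a) list" and r = r, OF _ assms(3)
      W]]
  have b: "length b = D + 1" "hd b \<noteq> 0" and z: "length z = D"
    using assms by (auto simp: b_def z_def hd_dense_coeffs)
  note re = runsD[OF runs_terms_mod[OF assms(1) o z b assms(4), of r]]
  note al = runsD[OF runs_all_zero[OF W, of r "terms_mod F off b z"]]
  define X where "X = (N + 1) ^ 4"
  have X: "k \<le> X" if "k \<le> N + 1" for k
    using that self_le_power[of "N + 1" 4] by (simp add: X_def)
  have 1: "call_cost (prog r) W DENSE_COEFFS_FUN [encode_terms L, VNum off, VNum D] \<le> 60 * X"
  proof -
    have "60 * (D + 1) * (length L + 1) \<le> 60 * ((N + 1) * (N + 1))"
      using assms unfolding mult.assoc by (intro mult_le_mono) auto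
    also have "\<dots> \<le> 60 * X" using power_increasing[of 2 4 "N + 1"]
        by (simp add: power2_eq_square X_def)
    finally show ?thesis using d1(3) by linarith
  qed
  have 2: "call_cost (prog r) W DENSE_COEFFS_FUN [VNil :: 'a val, VNum off, VNum D] \<le> 60 * X"
    using d2(3) X[of "D + 1"] assms by simp
  have 3: "call_cost (prog r) W TERMS_MOD_FUN [encode_terms F, VNum off, encode_coeffs b,
      encode_coeffs z] \<le> 320 * X"
  proof -
    \<comment> \<open>The dominating cost: terms of \<open>F\<close> times bits per exponent times
      the square of the dense length, whence the fourth power of \<open>N + 1\<close>.\<close>
    have "300 * length F * ((W + 1) * (D + 1)\<^sup>2) \<le> 300 * ((N + 1) * ((N + 1) * (N + 1)\<^sup>2))"
      using assms unfolding mult.assoc by (intro mult_le_mono power_mono) auto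
    also have "\<dots> = 300 * X" by (simp add: X_def power4_eq_xxxx power2_eq_square mult_ac)
    finally show ?thesis using re(3) X[of 1] by simp
  qed
  have 4: "call_cost (prog r) W ALL_ZERO_FUN [encode_coeffs (terms_mod F off b z)] \<le> 30 * X"
    using al(3) X[of "D + 1"] assms z by simp
  have 5: "1 \<le> X" by (simp add: X_def)
  show ?thesis
    unfolding X_def[symmetric]
    by (rule runsI) (use d1(1,2) d2(1,2) re(1,2) al(1,2) 1 2 3 4 5 in
      \<open>simp_all add: prog_nth dense_divides_body_def dense_divides_def dense_coeffs_Nil flip:
          b_def z_def\<close>)
qed

section \<open>Doubling the gap\<close>

lemma length_mul_term [simp]: "length (mul_term e a L acc) = length L + length acc"
  by (simp add: mul_term_def)

lemma length_mul_terms [simp]: "length (mul_terms K L) = length K * length L"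
  by (induction K L rule: mul_terms.induct) auto

lemma exps_lt_mul_term:
  "e + x \<le> y \<Longrightarrow> exps_lt x L \<Longrightarrow> exps_lt y acc \<Longrightarrow> exps_lt y (mul_term e a L acc)"
  by (fastforce simp: mul_term_def exps_lt_def)

lemma exps_lt_mul_terms: "exps_lt x K \<Longrightarrow> exps_lt y L \<Longrightarrow> exps_lt (x + y) (mul_terms K L)"
proof (induction K)
  case (Cons k K)
  then show ?case by (cases k) (auto intro!: exps_lt_mul_term)
qed simp

lemma exps_lt_mono: "exps_lt x L \<Longrightarrow> x \<le> y \<Longrightarrow> exps_lt y L"
  by (auto simp: exps_lt_def)

text \<open>
  Multiplication by the term \<open>- 1\<close> of exponent 0 negates.
\<close>

definition cross_diff :: "(nat \<times> 'a::field) list \<Rightarrow> (nat \<times> 'a) list \<Rightarrow> (nat \<times> 'a) list \<Rightarrow> nat \<Rightarrow>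
    (nat \<times> 'a) list" where
  "cross_diff F A B K = mul_term 0 (- 1) (mul_terms (filter (\<lambda>y. \<not> fst y < K) F) A) (mul_terms
      (filter (\<lambda>y. fst y < K) F) B)"

text \<open>\<open>DB\<close> is the degree of the upper part after removal of \<open>X ^ K\<close>.
  The comparison selects the factor that is expanded densely, so only \<open>min DA DB\<close>
  enters the cost.\<close>

definition split_test :: "(nat \<times> 'a::field) list \<Rightarrow> (nat \<times> 'a) list \<Rightarrow> (nat \<times> 'a)
    list \<Rightarrow> nat \<Rightarrow> nat \<Rightarrow> nat \<Rightarrow> bool" where
  "split_test F A B K DA DB \<longleftrightarrow>
     (\<forall>y \<in> set (cross_diff F A B K). coeff (poly_of (cross_diff F A B K)) (fst y) = 0) \<and>
     (if DA < DB then dense_divides (filter (\<lambda>y. fst y < K) F) A DA 0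
      else dense_divides (filter (\<lambda>y. \<not> fst y < K) F) B DB K)"

lemma runs_split_test:
  assumes "exps_lt x F" "exps_lt x A" "exps_lt x B" "2 * x \<le> 2 ^ W" "K < 2 ^ W" "2 \<le> W"
    "DA < 2 ^ W" "K + DB < 2 ^ W"
    "coeff (poly_of A) DA \<noteq> 0" "coeff (poly_of B) (K + DB) \<noteq> 0"
    "length F \<le> N" "length A \<le> N" "length B \<le> N" "W \<le> N" "min DA DB \<le> N"
  shows "runs (prog r) W SPLIT_TEST_FUN [encode_terms F, encode_terms A, encode_terms B, VNum K,
      VNum DA, VNum DB]
    (VNum (of_bool (split_test F A B K DA DB))) (2000 * (N + 1) ^ 4)"
proof -
  define Fl where "Fl = filter (\<lambda>y. fst y < K) F"
  define Fh where "Fh = filter (\<lambda>y. \<not> fst y < K) F"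
  define C where "C = cross_diff F A B K"
  define X where "X = (N + 1) ^ 4"
  have W: "0 < W" and x: "x \<le> 2 ^ W" using assms by auto
  have F: "exps_lt (2 ^ W) F" "exps_lt (2 ^ W) Fl" "exps_lt (2 ^ W) Fh"
    "exps_lt (2 ^ W) A" "exps_lt (2 ^ W) B"
    using assms(1-3)[THEN exps_lt_mono, OF x] by (simp_all add: Fl_def Fh_def)
  \<comment> \<open>The product of two lists with exponents below \<open>x\<close> has exponents
    below \<open>2 * x\<close>; the hypothesis on \<open>2 * x\<close> serves this.\<close>
  have ml: "exps_lt (2 ^ W) (mul_terms Fl B)" "exps_lt (2 ^ W) (mul_terms Fh A)"
    using assms by (auto simp: Fl_def Fh_def intro!: exps_lt_mono[OF exps_lt_mul_terms[of x _ x]])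
  have C: "C = mul_term 0 (- 1) (mul_terms Fh A) (mul_terms Fl B)"
    by (simp add: C_def cross_diff_def Fl_def Fh_def)
  have Clt: "exps_lt (2 ^ W) C" unfolding C using ml by (intro exps_lt_mul_term) auto
  have l: "length Fl \<le> N" "length Fh \<le> N"
    unfolding Fl_def Fh_def using assms(11) length_filter_le le_trans by blast+
  have lA: "length Fh * length A \<le> N * N" and lB: "length Fl * length B \<le> N * N"
    using l assms by (auto intro: mult_le_mono)
  have lC: "length C \<le> 2 * (N * N)"
    using lA lB by (simp add: C)
  have f1: "runs (prog r) W FILTER_FUN [VNum 1, VNum K, encode_terms F] (encode_terms Fl) (30 *
      (length F + 1))"
    using runs_filter[OF F(1) assms(5) W, of r True] by (simp add: Fl_def)
  have f2: "runs (prog r) W FILTER_FUN [VNum 0, VNum K, encode_terms F] (encode_terms Fh) (30 *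
      (length F + 1))"
    using runs_filter[OF F(1) assms(5) W, of r False] by (simp add: Fh_def)
  note f1 = runsD[OF f1] and f2 = runsD[OF f2]
  note m1 = runsD[OF runs_mul_terms[OF F(5) F(2), of r]]
  note m2 = runsD[OF runs_mul_terms[OF F(4) F(3), of r]]
  have "(0::nat) < 2 ^ W" by simp
  note mc = runsD[OF runs_mul_term[OF ml(2) this, of r "- 1" "mul_terms Fl B", folded C]]
  note ze = runsD[OF runs_vanish[OF Clt Clt W, of r]]
  have N4: "(N + 1) * (N + 1) \<le> X"
    using power_increasing[of 2 4 "N + 1"] by (simp add: X_def power2_eq_square)
  have N1: "N + 1 \<le> X"
    using self_le_power[of "N + 1" 4] by (simp add: X_def)
  have f13: "call_cost (prog r) W FILTER_FUN [VNum 1, VNum K, encode_terms F] \<le> 30 * X"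
    using f1(3) N1 assms(11) by simp
  have f23: "call_cost (prog r) W FILTER_FUN [VNum 0, VNum K, encode_terms F] \<le> 30 * X"
    using f2(3) N1 assms(11) by simp
  have mX: "30 * (k + 1) * (j + 2) \<le> 60 * X" if "k \<le> N" "j \<le> N" for k j
  proof -
    have "(k + 1) * (j + 2) \<le> (N + 1) * (2 * (N + 1))"
      using that by (intro mult_le_mono) auto
    then show ?thesis using N4 by (simp add: algebra_simps)
  qed
  have m13: "call_cost (prog r) W MUL_TERMS_FUN [encode_terms Fl, encode_terms B] \<le> 60 * X"
    using m1(3) mX[of "length Fl" "length B"] l assms by linarith
  have m23: "call_cost (prog r) W MUL_TERMS_FUN [encode_terms Fh, encode_terms A] \<le> 60 * X"
    using m2(3) mX[of "length Fh" "length A"] l assms by linarith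
  have mc3: "call_cost (prog r) W MUL_TERM_FUN
     [VNum 0, VField (- 1), encode_terms (mul_terms Fh A), encode_terms (mul_terms Fl B)] \<le> 30 * X"
    using mc(3) lA N4 by (simp add: algebra_simps)
  \<comment> \<open>The difference has up to \<open>2 * N ^ 2\<close> terms, and testing each of its
    exponents against the whole list is quadratic: again of order \<open>N ^ 4\<close>.\<close>
  have zX: "30 * (length C + 1) * (length C + 2) \<le> 120 * X"
  proof -
    have "length C + 1 \<le> 2 * ((N + 1) * (N + 1))" "length C + 2 \<le> 2 * ((N + 1) * (N + 1))"
      using lC by (simp_all add: algebra_simps)
    then have "(length C + 1) * (length C + 2) \<le> (2 * ((N + 1) * (N + 1))) * (2 * ((N + 1) *
        (N + 1)))"
      by (intro mult_le_mono)
    also have "\<dots> = 4 * X"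
    proof -
      have "(2 * (M * M)) * (2 * (M * M)) = 4 * M ^ 4" for M :: nat
        by (simp add: power4_eq_xxxx)
      then show ?thesis by (simp only: X_def)
    qed
    finally show ?thesis by (simp only: mult.assoc)
  qed
  have ze3: "call_cost (prog r) W VANISH_FUN [encode_terms C, encode_terms C] \<le> 120 * X"
    using ze(3) zX by linarith
  have d: "0 + DA < 2 ^ W" "coeff (poly_of A) (0 + DA) \<noteq> 0" using assms by simp_all
  show ?thesis
  proof (cases "DA < DB")
    case True
    then have D: "DA \<le> N" using assms(15) by simp
    have DB: "DB < 2 ^ W" using assms(8) by simp
    note dt = runsD[OF runs_dense_divides[OF F(2,4) d(1) assms(6) d(2) l(1) assms(12) assms(14) D,
        of r, folded X_def]]
    show ?thesis
      unfolding X_def[symmetric]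
      by (rule runsI) (use True DB assms(5-8) f1(1,2) f2(1,2) m1(1,2) m2(1,2) mc(1,2) ze(1,2)
          f13 f23 m13 m23 mc3 ze3 dt N1 in
        \<open>simp_all add: prog_nth split_test_body_def split_test_def flip: Fl_def Fh_def C_def\<close>)
  next
    case False
    then have D: "DB \<le> N" using assms(15) by simp
    have DB: "DB < 2 ^ W" using assms(8) by simp
    note dt = runsD[OF runs_dense_divides[OF F(3,5) assms(8) assms(6) assms(10) l(2) assms(13)
        assms(14) D, of r, folded X_def]]
    show ?thesis
      unfolding X_def[symmetric]
      by (rule runsI) (use False DB assms(5-8) f1(1,2) f2(1,2) m1(1,2) m2(1,2) mc(1,2) ze(1,2)
          f13 f23 m13 m23 mc3 ze3 dt N1 in
        \<open>simp_all add: prog_nth split_test_body_def split_test_def flip: Fl_def Fh_def C_def\<close>)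
  qed
qed

lemma poly_of_mul_term [simp]: "poly_of (mul_term e a L acc) = monom a e * poly_of L + poly_of acc"
  by (induction L) (auto simp: mul_term_def mult_monom algebra_simps)

lemma poly_of_mul_terms [simp]: "poly_of (mul_terms K L) = poly_of K * poly_of L"
  by (induction K L rule: mul_terms.induct) (auto simp: algebra_simps)

section \<open>The loop of gap doublings\<close>

fun gap_loop where
  "gap_loop 0 F A B K DA DB = split_test F A B K DA DB"
| "gap_loop (Suc i) F A B K DA DB = gap_loop i (mul_terms F (mul_term 0 (- 1) B A)) (mul_terms A A)
     (mul_term 0 (- 1) (mul_terms B B) []) (K + K) (DA + DA) (DB + DB)"

text \<open>One round multiplies \<open>F\<close>, of at most \<open>l\<close> terms, by the
  concatenation of the two parts of \<open>G\<close>, of at most \<open>2 * l\<close> terms; the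
  squares of the parts are no longer than that.\<close>

fun length_bound :: "nat \<Rightarrow> nat \<Rightarrow> nat" where
  "length_bound 0 l = l"
| "length_bound (Suc i) l = length_bound i (2 * l * l)"

lemma length_bound_le: "l \<le> length_bound i l"
proof (induction i arbitrary: l)
  case (Suc i)
  have "l \<le> 2 * l * l" by (cases l) auto
  also have "\<dots> \<le> length_bound i (2 * l * l)" by (rule Suc)
  finally show ?case by simp
qed simp

lemma monom_0_uminus_1: "monom (- 1) 0 = (- 1 :: 'a::comm_ring_1 poly)"
  by (metis minus_monom monom_eq_1)

text \<open>Exponents double in each of the \<open>i\<close> rounds and once more in the products of
  the final test, hence \<open>2 ^ Suc i * x\<close>. Likewise \<open>length_bound i l\<close> and
  \<open>2 ^ i * min DA DB\<close> measure the data that reach the final test.\<close>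

lemma runs_gap_loop:
  fixes F A B :: "(nat \<times> 'a::field) list"
  assumes "exps_lt x F" "exps_lt x A" "exps_lt x B" "2 ^ Suc i * x \<le> 2 ^ W" "2 \<le> W" "i < W"
    "K + DB < x" "DA < x"
    "degree (poly_of A) = DA" "poly_of A \<noteq> 0" "degree (poly_of B) = K + DB" "poly_of B \<noteq> 0"
    "length F \<le> l" "length A \<le> l" "length B \<le> l" "length_bound i l \<le> N" "W \<le> N"
        "2 ^ i * min DA DB \<le> N"
  shows "runs (prog r) W GAP_LOOP_FUN
    [VNum i, encode_terms F, encode_terms A, encode_terms B, VNum K, VNum DA, VNum DB]
    (VNum (of_bool (gap_loop i F A B K DA DB))) (3000 * (i + 1) * (N + 1) ^ 4)"
  using assms
proof (induction i arbitrary: x F A B K DA DB l)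
  case 0
  define X where "X = (N + 1) ^ 4"
  \<comment> \<open>The dense reduction divides by the leading coefficient of its modulus.\<close>
  have lc: "coeff (poly_of A) DA \<noteq> 0" "coeff (poly_of B) (K + DB) \<noteq> 0"
    using "0.prems"(9-12) leading_coeff_neq_0 by metis+
  have b: "K < 2 ^ W" "DA < 2 ^ W" "K + DB < 2 ^ W" "DB < 2 ^ W" "2 * x \<le> 2 ^ W"
    "length F \<le> N" "length A \<le> N" "length B \<le> N" "min DA DB \<le> N"
    using "0.prems" by auto
  note fi = runsD[OF runs_split_test[OF "0.prems"(1-3) b(5,1) "0.prems"(5) b(2,3) lc b(6-8)
      "0.prems"(17) b(9), of r, folded X_def]]
  have X: "1 \<le> X" by (simp add: X_def)
  show ?case
    unfolding X_def[symmetric]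
    by (rule runsI) (use fi X b(1-4) in \<open>simp_all add: prog_nth gap_loop_body_def\<close>)
next
  case (Suc i)
  define X where "X = (N + 1) ^ 4"
  define F' where "F' = mul_terms F (mul_term 0 (- 1) B A)"
  define A' where "A' = mul_terms A A"
  define B' where "B' = mul_term 0 (- 1) (mul_terms B B) []"
  have "2 * x \<le> 2 ^ Suc (Suc i) * x" by simp
  then have x2: "2 * x \<le> 2 ^ W" using Suc.prems(4) by (rule le_trans)
  have lW: "exps_lt (2 ^ W) F" "exps_lt (2 ^ W) A" "exps_lt (2 ^ W) B"
    using Suc.prems(1-3) x2 exps_lt_mono[of x _ "2 ^ W"] by auto
  have neg: "exps_lt x (mul_term 0 (- 1) B A)"
    using Suc.prems(2,3) by (intro exps_lt_mul_term) auto
  then have negW: "exps_lt (2 ^ W) (mul_term 0 (- 1) B A)"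
    using exps_lt_mono x2 by (metis add_leD1 mult_2)
  have F': "exps_lt (2 * x) F'" and A': "exps_lt (2 * x) A'" and BB: "exps_lt (2 * x)
      (mul_terms B B)"
    using exps_lt_mul_terms[OF Suc.prems(1) neg] exps_lt_mul_terms[OF Suc.prems(2) Suc.prems(2)]
      exps_lt_mul_terms[OF Suc.prems(3) Suc.prems(3)] by (auto simp: F'_def A'_def mult_2)
  then have B': "exps_lt (2 * x) B'" unfolding B'_def by (intro exps_lt_mul_term) auto
  have BBW: "exps_lt (2 ^ W) (mul_terms B B)" using BB x2 exps_lt_mono by blast
  have pA: "poly_of A' = poly_of A * poly_of A" by (simp add: A'_def)
  have pB: "poly_of B' = - (poly_of B * poly_of B)" by (simp add: B'_def monom_0_uminus_1)
  have dA: "degree (poly_of A') = DA + DA" "poly_of A' \<noteq> 0"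
    using Suc.prems(9,10) by (auto simp: pA degree_mult_eq)
  have dB: "degree (poly_of B') = (K + K) + (DB + DB)" "poly_of B' \<noteq> 0"
    using Suc.prems(11,12) by (auto simp: pB degree_mult_eq)
  have l: "length F' \<le> 2 * l * l" "length A' \<le> 2 * l * l" "length B' \<le> 2 * l * l"
  proof -
    have "length F * (length B + length A) \<le> l * (l + l)"
      using Suc.prems(13-15) by (intro mult_le_mono add_mono) auto
    then show "length F' \<le> 2 * l * l" by (simp add: F'_def algebra_simps)
    have "length A * length A \<le> l * l" "length B * length B \<le> l * l"
      using Suc.prems(13-15) by (auto intro: mult_le_mono)
    then show "length A' \<le> 2 * l * l" "length B' \<le> 2 * l * l" by (auto simp: A'_def B'_def)
  qed
  have g: "length_bound i (2 * l * l) \<le> N" using Suc.prems(16) by simp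
  have lN: "length F \<le> N" "length A \<le> N" "length B \<le> N"
    using Suc.prems(13-16) length_bound_le[of l "Suc i"] by linarith+
  have r1: "K + K + (DB + DB) < 2 * x" "DA + DA < 2 * x" "2 ^ Suc i * (2 * x) \<le> 2 ^ W" "i < W"
    "2 ^ i * min (DA + DA) (DB + DB) \<le> N"
    using Suc.prems(4,6-8,18) by (auto simp: algebra_simps min_def split: if_splits)
  note IH = runsD[OF Suc.IH[OF F' A' B' r1(3) Suc.prems(5) r1(4) r1(1,2) dA dB l g Suc.prems(17)
      r1(5), folded X_def]]
  have z: "(0::nat) < 2 ^ W" by simp
  note c1 = runsD[OF runs_mul_term[OF lW(3) z, of r "- 1" A]]
  note c2 = runsD[OF runs_mul_terms[OF negW lW(1), of r]]
  note c3 = runsD[OF runs_mul_terms[OF lW(2) lW(2), of r]]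
  note c4 = runsD[OF runs_mul_terms[OF lW(3) lW(3), of r]]
  note c5 = runsD[OF runs_mul_term[OF BBW z, of r "- 1" "[]"]]
  have N4: "(N + 1) * (N + 1) \<le> X"
    using power_increasing[of 2 4 "N + 1"] by (simp add: X_def power2_eq_square)
  have N1: "N + 1 \<le> X"
    using self_le_power[of "N + 1" 4] by (simp add: X_def)
  have mX: "30 * (k + 1) * (j + 2) \<le> 60 * X" if "k \<le> N" "j \<le> 2 * N" for k j
  proof -
    have "(k + 1) * (j + 2) \<le> (N + 1) * (2 * (N + 1))"
      using that by (intro mult_le_mono) auto
    then show ?thesis using N4 by (simp add: algebra_simps)
  qed
  have c13: "call_cost (prog r) W MUL_TERM_FUN [VNum 0, VField (- 1), encode_terms B,
      encode_terms A] \<le> 30 * X"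
    by (rule c1(3)[THEN le_trans]) (use lN N1 in simp)
  have c23: "call_cost (prog r) W MUL_TERMS_FUN [encode_terms F, encode_terms (mul_term 0 (- 1)
      B A)] \<le> 60 * X"
    by (rule c2(3)[THEN le_trans], rule mX) (use lN in simp_all)
  have c33: "call_cost (prog r) W MUL_TERMS_FUN [encode_terms A, encode_terms A] \<le> 60 * X"
    using c3(3) mX[of "length A" "length A"] lN by linarith
  have c43: "call_cost (prog r) W MUL_TERMS_FUN [encode_terms B, encode_terms B] \<le> 60 * X"
    using c4(3) mX[of "length B" "length B"] lN by linarith
  have c53: "call_cost (prog r) W MUL_TERM_FUN [VNum 0, VField (- 1), encode_terms
      (mul_terms B B), VNil] \<le> 30 * X"
  proof -
    have "length B * length B \<le> N * N" using lN by (auto intro: mult_le_mono)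
    then show ?thesis using c5(3) N4 by (simp add: algebra_simps)
  qed
  have kb: "K < 2 ^ W" "DA < 2 ^ W" "DB < 2 ^ W" "Suc i < 2 ^ W"
    using Suc.prems(6-8) x2 less_exp[of W] by linarith+
  have cost: "3000 * (i + 1) * X + 3000 * X = 3000 * (Suc i + 1) * X"
    by (simp add: algebra_simps)
  show ?case
    unfolding X_def[symmetric] cost[symmetric]
    by (rule runsI) (use IH c1(1,2) c2(1,2) c3(1,2) c4(1,2) c5(1,2)
        c13 c23 c33 c43 c53 kb N1 Suc.prems(5) in
      \<open>simp_all add: prog_nth gap_loop_body_def flip: F'_def A'_def B'_def\<close>)
qed

text \<open>The function that the program computes. For sparse lists, if \<open>G\<close> divides a
  nonzero \<open>F\<close>, the quotient has degree \<open>n - 1\<close>. The first exponent of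
  \<open>G\<close> is merely the initial candidate of the search.\<close>

definition divides_test :: "nat \<Rightarrow> (nat \<times> 'a::field) list \<Rightarrow> (nat \<times> 'a) list \<Rightarrow> bool" where
  "divides_test r F G = (let n = max_exp F + 1 - max_exp G; K = best_split r G (fst (hd G)) G n
      (max_exp G);
     A = filter (\<lambda>y. fst y < K) G; B = filter (\<lambda>y. \<not> fst y < K) G
   in gap_loop r F A B K (max_exp A) (max_exp G - K))"

text \<open>The properties of the chosen split are hypotheses here, which keeps the cost analysis
  apart from the reason why a good split is found; \<open>runs_prog\<close> discharges them.\<close>

lemma runs_main:
  fixes F G :: "(nat \<times> 'a::field) list" and r :: nat
  defines "n \<equiv> max_exp F + 1 - max_exp G"
  defines "K \<equiv> best_split r G (fst (hd G)) G n (max_exp G)"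
  defines "A \<equiv> filter (\<lambda>y. fst y < K) G"
  defines "B \<equiv> filter (\<lambda>y. \<not> fst y < K) G"
  assumes "exps_lt x F" "exps_lt x G" "G \<noteq> []" "2 ^ Suc r * x \<le> 2 ^ W" "2 \<le> W" "r < W"
      "K \<le> max_exp G"
    "degree (poly_of A) = max_exp A" "poly_of A \<noteq> 0" "degree (poly_of B) = max_exp G"
        "poly_of B \<noteq> 0"
    "length F \<le> l" "length G \<le> l" "length_bound r l \<le> N" "W \<le> N" "2 ^ r * min (max_exp A)
        (max_exp G - K) \<le> N"
  shows "runs (prog r) W MAIN_FUN [encode_terms F, encode_terms G]
    (VNum (of_bool (divides_test r F G))) (4000 * (r + 1) * (N + 1) ^ 4)"
proof -
  define X where "X = (N + 1) ^ 4"
  have "2 * x \<le> 2 ^ Suc r * x" by simp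
  then have x2: "2 * x \<le> 2 ^ W" using assms(8) by (rule le_trans)
  have lW: "exps_lt (2 ^ W) F" "exps_lt (2 ^ W) G"
    using assms(5,6) x2 exps_lt_mono[of x _ "2 ^ W"] by auto
  have W: "0 < W" using assms by simp
  obtain e a G' where G: "G = (e, a) # G'" using assms(7) by (cases G) auto
  have ex: "e < x" using assms(6) G by simp
  have x: "0 < x" "max_exp F < x" "max_exp G < x" using ex max_exp_lt assms(5,6) by auto
  have n: "max_exp F + 1 < 2 ^ W" "n < 2 ^ W" "max_exp G + 1 < 2 ^ W" "max_exp G < 2 ^ W"
      "max_exp F < 2 ^ W"
    using x x2 by (auto simp: n_def)
  \<comment> \<open>The scores multiply exponents by \<open>2 ^ r\<close>; the room reserved for the
    gap loop covers this as well.\<close>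
  have rk: "k * 2 ^ r < 2 ^ W" if "k < x" for k
  proof -
    have "k * 2 ^ r < x * 2 ^ r" using that by simp
    also have "x * 2 ^ r \<le> 2 ^ Suc r * x" by simp
    also note assms(8)
    finally show ?thesis .
  qed
  have P: "\<forall>y \<in> set G. fst y * 2 ^ r < 2 ^ W" "e * 2 ^ r < 2 ^ W"
    using rk assms(6) ex by (auto simp: exps_lt_def)
  note am = runsD[OF runs_best_split[OF lW(2) W assms(10) n(2,3) P]]
  have Ke: "K = best_split r G e G n (max_exp G)" by (simp add: K_def G)
  note am = am[folded Ke]
  have K: "K < 2 ^ W" using assms(11) n(4) by simp
  have f1: "runs (prog r) W FILTER_FUN [VNum 1, VNum K, encode_terms G] (encode_terms A) (30 *
      (length G + 1))"
    using runs_filter[OF lW(2) K W, of r True] by (simp add: A_def)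
  have f2: "runs (prog r) W FILTER_FUN [VNum 0, VNum K, encode_terms G] (encode_terms B) (30 *
      (length G + 1))"
    using runs_filter[OF lW(2) K W, of r False] by (simp add: B_def)
  note f1 = runsD[OF f1] and f2 = runsD[OF f2]
  note m1 = runsD[OF runs_max_exp[OF lW(1), of r]]
  note m2 = runsD[OF runs_max_exp[OF lW(2), of r]]
  have A: "exps_lt x A" "exps_lt x B" "exps_lt (2 ^ W) A" using assms(6) lW
      by (auto simp: A_def B_def)
  note m3 = runsD[OF runs_max_exp[OF A(3), of r]]
  have ll: "length A \<le> l" "length B \<le> l"
    unfolding A_def B_def using assms(17) length_filter_le le_trans by blast+
  have mA: "max_exp A < x" using A x max_exp_lt by blast
  have KG: "K + (max_exp G - K) < x" "degree (poly_of B) = K + (max_exp G - K)"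
    using x assms(11,14) by auto
  note lo = runsD[OF runs_gap_loop[OF assms(5) A(1,2) assms(8-10) KG(1) mA assms(12,13) KG(2)
      assms(15,16) ll assms(18-20), of r, folded X_def]]
  have lN: "length F \<le> N" "length G \<le> N" "length A \<le> N"
    using assms(16-18) ll length_bound_le[of l r] by linarith+
  have N4: "(N + 1) * (N + 1) \<le> X"
    using power_increasing[of 2 4 "N + 1"] by (simp add: X_def power2_eq_square)
  have N1: "N + 1 \<le> X"
    using self_le_power[of "N + 1" 4] by (simp add: X_def)
  have am3: "call_cost (prog r) W BEST_SPLIT_FUN [encode_terms G, VNum e, encode_terms G, VNum n,
      VNum (max_exp G)] \<le> 240 * X"
  proof -
    have "(length G + 1) * (length G + 1) \<le> (N + 1) * (N + 1)"
      using lN by (intro mult_le_mono) auto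
    then have "240 * (length G + 1) * (length G + 1) \<le> 240 * X" using N4
        by (simp add: algebra_simps)
    then show ?thesis using am(3) by linarith
  qed
  have c: "call_cost (prog r) W FILTER_FUN [VNum 1, VNum K, encode_terms G] \<le> 30 * X"
    "call_cost (prog r) W FILTER_FUN [VNum 0, VNum K, encode_terms G] \<le> 30 * X"
    "call_cost (prog r) W MAX_EXP_FUN [encode_terms F] \<le> 30 * X"
    "call_cost (prog r) W MAX_EXP_FUN [encode_terms G] \<le> 30 * X"
    "call_cost (prog r) W MAX_EXP_FUN [encode_terms A] \<le> 30 * X"
    using f1(3) f2(3) m1(3) m2(3) m3(3) lN N1 by simp_all
  have rW: "r < 2 ^ W" using assms(10) less_exp[of W] by linarith
  have cost: "3000 * (r + 1) * X + 1000 * X \<le> 4000 * (r + 1) * X"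
    by (simp add: algebra_simps)
  have hG: "encode_terms G = VPair (VPair (VNum e) (VField a)) (encode_terms G')"
    by (simp add: G)
  have mL: "divides_test r F G = gap_loop r F A B K (max_exp A) (max_exp G - K)"
    by (simp add: divides_test_def Let_def A_def B_def K_def n_def)
  have nn: "n = Suc (max_exp F) - max_exp G" by (simp add: n_def)
  have "runs (prog r) W MAIN_FUN [encode_terms F, encode_terms G] (VNum (of_bool
      (divides_test r F G)))
    (3000 * (r + 1) * X + 1000 * X)"
    by (rule runsI) (use am(1,2) am3 f1(1,2) f2(1,2) m1(1,2) m2(1,2) m3(1,2) c lo n K rW W N1 in
      \<open>simp_all add: prog_nth main_body_def mL nn hG\<close>)
  then show ?thesis
    using cost unfolding X_def[symmetric] by (auto simp: runs_def)
qed

section \<open>Correctness of the arithmetic modulo a dense polynomial\<close>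

fun poly_of_coeffs :: "'a::comm_monoid_add list \<Rightarrow> 'a poly" where
  "poly_of_coeffs [] = 0"
| "poly_of_coeffs (a # u) = monom a (length u) + poly_of_coeffs u"

lemma coeff_poly_of_coeffs_0: "length u \<le> i \<Longrightarrow> coeff (poly_of_coeffs u) i = 0"
  by (induction u) auto

lemma poly_of_coeffs_replicate_0 [simp]: "poly_of_coeffs (replicate D 0) = 0"
  by (induction D) auto

lemma poly_of_coeffs_eq_0_iff: "poly_of_coeffs u = 0 \<longleftrightarrow> (\<forall>a \<in> set u. a = 0)"
proof (induction u)
  case (Cons a u)
  have "a = 0" if "monom a (length u) + poly_of_coeffs u = 0"
    using arg_cong[OF that, of "\<lambda>p. coeff p (length u)"] by (simp add: coeff_poly_of_coeffs_0)
  then show ?case using Cons by auto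
qed simp

lemma poly_of_coeffs_shift_sub:
  "length v = length u + 1 \<Longrightarrow> poly_of_coeffs (shift_sub u a v b) = pCons a (poly_of_coeffs u)
      - smult b (poly_of_coeffs v)"
proof (induction u a v b rule: shift_sub.induct)
  case (2 a c v b)
  then show ?case by (simp add: monom_0 smult_monom)
next
  case (3 x u a c v b)
  then have "poly_of_coeffs (shift_sub u a v b) = pCons a (poly_of_coeffs u) - smult b
      (poly_of_coeffs v)" "length v = Suc (length u)" by auto
  moreover have "pCons a (monom x (length u) + poly_of_coeffs u) = monom x (Suc (length u))
      + pCons a (poly_of_coeffs u)"
    by (simp add: monom_Suc)
  ultimately show ?case
    using 3 by (simp add: smult_add_right smult_monom diff_monom[symmetric] algebra_simps)
qed auto

text \<open>\<open>pCons a p\<close> is \<open>a + X * p\<close>. The leading terms dropped from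
  \<open>X * u + a\<close> and from the multiple \<open>x / c\<close> of the modulus are equal, so
  the result differs from \<open>X * u + a\<close> by that multiple. For empty \<open>u\<close> the
  modulus is a unit.\<close>

lemma poly_of_coeffs_shift_mod:
  assumes "length v = length u + 1" "hd v \<noteq> 0"
  shows "[poly_of_coeffs (shift_mod u a v) = pCons a (poly_of_coeffs u)] (mod (poly_of_coeffs v))"
proof (cases u)
  case Nil
  then obtain c where "v = [c]" "c \<noteq> 0" using assms by (cases v) auto
  then have "poly_of_coeffs v dvd 1" by (simp add: monom_0 is_unit_const_poly_iff dvd_field_iff)
  then show ?thesis by (meson cong_iff_dvd_diff dvd_trans one_dvd)
next
  case (Cons x u')
  then obtain c v' where v: "v = c # v'" "c \<noteq> 0" "length v' = length u' + 1"
    using assms by (cases v) auto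
  have "poly_of_coeffs (shift_mod u a v) = pCons a (poly_of_coeffs u') - smult (x / c)
      (poly_of_coeffs v')"
    using v Cons by (simp add: poly_of_coeffs_shift_sub)
  also have "\<dots> = pCons a (poly_of_coeffs u) - smult (x / c) (poly_of_coeffs v)"
    using v Cons by (simp add: smult_add_right smult_monom monom_Suc algebra_simps)
  finally show ?thesis by (simp add: cong_iff_dvd_diff dvd_smult)
qed

lemma poly_of_coeffs_add_scaled: "length u = length v \<Longrightarrow> poly_of_coeffs (add_scaled u c v)
    = poly_of_coeffs u + smult c (poly_of_coeffs v)"
proof (induction u c v rule: add_scaled.induct)
  case (2 x u c v)
  then obtain y v' where "v = y # v'" by (cases v) auto
  with 2 show ?case by (simp add: smult_add_right smult_monom add_monom[symmetric] algebra_simps)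
qed auto

text \<open>The invariant of Horner's rule: the coefficients still to be read shift the accumulator
  by \<open>length u\<close> places.\<close>

lemma poly_of_coeffs_mul_mod:
  assumes "length acc = D" "length v = D" "length b = D + 1" "hd b \<noteq> 0"
  shows "[poly_of_coeffs (mul_mod acc u v b) = poly_of_coeffs acc * monom 1 (length u)
      + poly_of_coeffs u * poly_of_coeffs v] (mod (poly_of_coeffs b))"
  using assms(1)
proof (induction u arbitrary: acc)
  case Nil
  then show ?case by (simp add: monom_0)
next
  case (Cons x u)
  let ?s = "shift_mod acc 0 b"
  have l: "length ?s = D" using Cons.prems assms by simp
  have "[poly_of_coeffs ?s = monom 1 1 * poly_of_coeffs acc] (mod (poly_of_coeffs b))"
    using poly_of_coeffs_shift_mod[of b acc 0] Cons.prems assms by (simp add: monom_altdef)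
  then have s: "[poly_of_coeffs (add_scaled ?s x v) = monom 1 1 * poly_of_coeffs acc + smult x
      (poly_of_coeffs v)] (mod (poly_of_coeffs b))"
    using l assms by (auto simp: poly_of_coeffs_add_scaled intro: cong_add)
  have "[poly_of_coeffs (mul_mod acc (x # u) v b) = poly_of_coeffs (add_scaled ?s x v) * monom 1
      (length u) + poly_of_coeffs u * poly_of_coeffs v] (mod (poly_of_coeffs b))"
    using Cons.IH[of "add_scaled ?s x v"] l by simp
  also have "[poly_of_coeffs (add_scaled ?s x v) * monom 1 (length u)
      + poly_of_coeffs u * poly_of_coeffs v =
      (monom 1 1 * poly_of_coeffs acc + smult x (poly_of_coeffs v)) * monom 1 (length u)
          + poly_of_coeffs u * poly_of_coeffs v] (mod (poly_of_coeffs b))"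
    by (intro cong_add cong_mult s cong_refl)
  also have "(monom 1 1 * poly_of_coeffs acc + smult x (poly_of_coeffs v)) * monom 1 (length u)
      + poly_of_coeffs u * poly_of_coeffs v =
    poly_of_coeffs acc * (monom 1 1 * monom 1 (length u)) + (smult x (monom 1 (length u))
        + poly_of_coeffs u) * poly_of_coeffs v"
    by (simp add: algebra_simps)
  also have "\<dots> = poly_of_coeffs acc * monom 1 (length (x # u)) + poly_of_coeffs (x # u)
      * poly_of_coeffs v"
    by (simp add: mult_monom smult_monom)
  finally show ?case .
qed

lemma poly_of_coeffs_power_mod:
  assumes "length b = D + 1" "hd b \<noteq> 0"
  shows "[poly_of_coeffs (power_mod e b (replicate D 0)) = monom 1 e] (mod (poly_of_coeffs b))"
proof (induction e rule: less_induct)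
  case (less e)
  let ?z = "replicate D (0 :: 'a)"
  show ?case
  proof (cases "e = 0")
    case True
    then show ?thesis
      using poly_of_coeffs_shift_mod[of b ?z 1] assms by (simp add: power_mod.simps[of 0] monom_0)
  next
    case False
    let ?h = "power_mod (e div 2) b ?z"
    let ?s = "mul_mod ?z ?h ?h b"
    have h: "[poly_of_coeffs ?h = monom 1 (e div 2)] (mod (poly_of_coeffs b))" using less False
        by simp
    have "[poly_of_coeffs ?s = poly_of_coeffs ?h * poly_of_coeffs ?h] (mod (poly_of_coeffs b))"
      using poly_of_coeffs_mul_mod[of ?z D ?h b ?h] assms by simp
    also have "[poly_of_coeffs ?h * poly_of_coeffs ?h = monom 1 (e div 2) * monom 1 (e div 2)]
        (mod (poly_of_coeffs b))"
      by (intro cong_mult h)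
    finally have s: "[poly_of_coeffs ?s = monom 1 (e div 2 + e div 2)] (mod (poly_of_coeffs b))"
      by (simp add: mult_monom)
    show ?thesis
    proof (cases "even e")
      case True
      then have "e div 2 + e div 2 = e" by auto
      then show ?thesis using True False s by (simp add: power_mod.simps[of e] Let_def)
    next
      case odd: False
      then have e: "Suc (e div 2 + e div 2) = e" by presburger
      have "[poly_of_coeffs (shift_mod ?s 0 b) = monom 1 1 * poly_of_coeffs ?s] (mod
          (poly_of_coeffs b))"
        using poly_of_coeffs_shift_mod[of b ?s 0] assms by (simp add: monom_altdef)
      also have "[monom 1 1 * poly_of_coeffs ?s = monom 1 1 * monom 1 (e div 2 + e div 2)] (mod
          (poly_of_coeffs b))"
        by (intro cong_mult s cong_refl)
      finally show ?thesis using odd False e by (simp add: power_mod.simps[of e] Let_def mult_monom)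
    qed
  qed
qed

lemma poly_of_coeffs_terms_mod:
  assumes "length b = D + 1" "hd b \<noteq> 0"
  shows "[poly_of_coeffs (terms_mod L off b (replicate D 0)) = poly_of (map (\<lambda>(e, a). (e - off,
      a)) L)] (mod (poly_of_coeffs b))"
proof (induction L)
  case (Cons x L)
  obtain e a where x: "x = (e, a)" by fastforce
  let ?z = "replicate D (0 :: 'a)"
  have "poly_of_coeffs (terms_mod (x # L) off b ?z) = poly_of_coeffs (terms_mod L off b ?z) +
      [:a:] * poly_of_coeffs (power_mod (e - off) b ?z)"
    using assms by (simp add: x poly_of_coeffs_add_scaled)
  also have "[\<dots> = poly_of (map (\<lambda>(e, a). (e - off, a)) L) + [:a:] * monom 1 (e - off)] (mod
      (poly_of_coeffs b))"
    by (intro cong_add cong_mult Cons.IH poly_of_coeffs_power_mod assms cong_refl)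
  finally show ?case by (simp add: x smult_monom add.commute)
qed simp

lemma coeff_poly_of_coeffs_dense_coeffs:
  "coeff (poly_of_coeffs (dense_coeffs L off D)) i = (if i \<le> D then coeff (poly_of L) (off + i)
      else 0)"
  by (induction D) (auto simp: le_Suc_eq)

lemma poly_of_shift:
  assumes "\<forall>y \<in> set L. off \<le> fst y"
  shows "poly_of L = monom 1 off * poly_of (map (\<lambda>(e, a). (e - off, a :: 'a::field)) L)"
  using assms
proof (induction L)
  case (Cons x L)
  then show ?case by (cases x) (simp add: mult_monom distrib_left)
qed simp

text \<open>Cancel \<open>X ^ off\<close> on both sides, which leaves a modulus \<open>p\<close>.
  The computed residue is congruent to the reduced \<open>F\<close> and has only
  \<open>D = degree p\<close> coefficients, so \<open>p\<close> divides it only if it is 0.\<close>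

lemma dense_divides_correct:
  fixes F L :: "(nat \<times> 'a::field) list"
  assumes "\<forall>y \<in> set F. off \<le> fst y" "monom 1 off dvd poly_of L" "degree (poly_of L) = off + D"
    "poly_of L \<noteq> 0"
  shows "dense_divides F L D off \<longleftrightarrow> poly_of L dvd poly_of F"
proof -
  from assms(2) obtain p where p: "poly_of L = monom 1 off * p" by (elim dvdE)
  then have p0: "p \<noteq> 0" using assms(4) by auto
  have m0: "monom 1 off \<noteq> (0 :: 'a poly)" by simp
  have "degree p = D"
    using assms(3) p p0 by (simp add: degree_mult_eq degree_monom_eq)
  define b where "b = dense_coeffs L off D"
  define f where "f = poly_of (map (\<lambda>(e, a). (e - off, a)) F)"
  have "coeff (poly_of L) (off + i) = coeff p i" for i
    by (simp add: p coeff_monom_mult)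
  then have bp: "poly_of_coeffs b = p"
    using \<open>degree p = D\<close> by (auto simp: b_def poly_eq_iff coeff_poly_of_coeffs_dense_coeffs
        coeff_eq_0)
  have lb: "length b = D + 1" by (simp add: b_def)
  have hb: "hd b \<noteq> 0"
    using assms(3,4) leading_coeff_neq_0[of "poly_of L"] by (simp add: b_def hd_dense_coeffs)
  define t where "t = terms_mod F off b (replicate D 0)"
  have lt: "length t = D" by (simp add: t_def)
  have c: "[poly_of_coeffs t = f] (mod p)"
    using poly_of_coeffs_terms_mod[OF lb hb, of F off] by (simp add: t_def f_def bp)
  have "dense_divides F L D off \<longleftrightarrow> poly_of_coeffs t = 0"
    by (simp add: dense_divides_def poly_of_coeffs_eq_0_iff t_def b_def)
  also have "\<dots> \<longleftrightarrow> p dvd poly_of_coeffs t"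
  proof
    assume d: "p dvd poly_of_coeffs t"
    show "poly_of_coeffs t = 0"
    proof (rule ccontr)
      assume "poly_of_coeffs t \<noteq> 0"
      then have "D \<le> degree (poly_of_coeffs t)" "coeff (poly_of_coeffs t) (degree
          (poly_of_coeffs t)) \<noteq> 0"
        using dvd_imp_degree_le[OF d] \<open>degree p = D\<close> by auto
      then show False using coeff_poly_of_coeffs_0[of t "degree (poly_of_coeffs t)"] lt by simp
    qed
  qed simp
  also have "\<dots> \<longleftrightarrow> p dvd f" using c by (rule cong_dvd_iff)
  also have "\<dots> \<longleftrightarrow> poly_of L dvd poly_of F"
    using poly_of_shift[OF assms(1)] m0 by (simp add: p f_def)
  finally show ?thesis .
qed

section \<open>Correctness of the divisibility test\<close>

lemma coeff_poly_of_notin: "e \<notin> fst ` set L \<Longrightarrow> coeff (poly_of L) e = 0"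
  by (induction L) auto

text \<open>Exponents outside the list have coefficient 0 anyway. This justifies the vanishing test
  of a list against itself, although exponents may repeat.\<close>

lemma poly_of_zero_iff: "poly_of L = 0 \<longleftrightarrow> (\<forall>y \<in> set L. coeff (poly_of L) (fst y) = 0)"
proof
  assume R: "\<forall>y \<in> set L. coeff (poly_of L) (fst y) = 0"
  show "poly_of L = 0"
  proof (rule poly_eqI)
    show "coeff (poly_of L) i = coeff 0 i" for i
      using R coeff_poly_of_notin[of i L] by (cases "i \<in> fst ` set L") auto
  qed
qed simp

lemma poly_of_filter_split:
  "poly_of (filter P L) + poly_of (filter (\<lambda>y. \<not> P y) L) = poly_of L"
  by (induction L) (auto simp: algebra_simps)

lemma coeff_poly_of_filter_lt: "k \<le> i \<Longrightarrow> coeff (poly_of (filter (\<lambda>y. fst y < k) L)) i = 0"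
  by (rule coeff_poly_of_notin) auto

lemma monom_dvd_poly_of_filter:
  "monom 1 k dvd (poly_of (filter (\<lambda>y. \<not> fst y < k) L) :: 'a::field poly)"
  using poly_of_shift[of "filter (\<lambda>y. \<not> fst y < k) L" k] by auto

text \<open>The difference \<open>l - l'\<close> equals \<open>h' - h\<close>, so it is divisible by
  \<open>X ^ k\<close> while all its coefficients from \<open>k\<close> on vanish.\<close>

lemma low_high_unique:
  fixes l l' h h' :: "'a::field poly"
  assumes "l + h = l' + h'" "\<And>i. k \<le> i \<Longrightarrow> coeff l i = 0" "\<And>i. k \<le> i \<Longrightarrow> coeff l' i = 0"
    "monom 1 k dvd h" "monom 1 k dvd h'"
  shows "l = l'" "h = h'"
proof -
  have d: "monom 1 k dvd l - l'"
  proof -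
    have "l - l' = h' - h" using assms(1) by (simp add: algebra_simps)
    then show ?thesis using assms(4,5) by (simp add: dvd_diff)
  qed
  then have "coeff (l - l') i = 0" if "i < k" for i
    using that by (auto simp: coeff_monom_mult simp del: coeff_diff elim!: dvdE)
  then have "coeff (l - l') i = 0" for i
    using assms(2,3) by (cases "i < k") auto
  then show "l = l'" by (simp add: poly_eq_iff)
  with assms(1) show "h = h'" by simp
qed

text \<open>The last hypothesis says, without subtraction, that a quotient has degree less than the
  gap \<open>K - DA\<close>.\<close>

lemma split_test_correct:
  fixes F A B :: "(nat \<times> 'a::field) list"
  assumes "poly_of A \<noteq> 0" "poly_of B \<noteq> 0" "monom 1 K dvd poly_of B"
    "degree (poly_of A) = DA" "degree (poly_of B) = K + DB" "DA < K"
    "degree (poly_of F) + DA < K + (K + DB)"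
  shows "split_test F A B K DA DB \<longleftrightarrow> poly_of A + poly_of B dvd poly_of F"
proof -
  define a where "a = poly_of A"
  define b where "b = poly_of B"
  define Fl where "Fl = filter (\<lambda>y. fst y < K) F"
  define Fh where "Fh = filter (\<lambda>y. \<not> fst y < K) F"
  define l where "l = poly_of Fl"
  define h where "h = poly_of Fh"
  have f: "poly_of F = l + h"
    using poly_of_filter_split[of "\<lambda>y. fst y < K" F] by (simp add: l_def h_def Fl_def Fh_def)
  have cr: "(\<forall>y \<in> set (cross_diff F A B K). coeff (poly_of (cross_diff F A B K)) (fst y) = 0)
      \<longleftrightarrow> l * b = h * a"
    by (subst poly_of_zero_iff[symmetric])
      (auto simp: cross_diff_def monom_0_uminus_1 a_def b_def l_def h_def Fl_def Fh_def)
  have d1: "dense_divides Fl A DA 0 \<longleftrightarrow> a dvd l"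
    using dense_divides_correct[of Fl 0 A DA] assms by (simp add: a_def l_def)
  have d2: "dense_divides Fh B DB K \<longleftrightarrow> b dvd h"
    using dense_divides_correct[of Fh K B DB] assms by (simp add: b_def h_def Fh_def)
  have fin: "split_test F A B K DA DB \<longleftrightarrow> l * b = h * a \<and> (if DA < DB then a dvd l else b dvd h)"
    using cr d1 d2 by (simp add: split_test_def flip: Fl_def Fh_def)
  have ab0: "a \<noteq> 0" "b \<noteq> 0" using assms by (simp_all add: a_def b_def)
  have dab: "degree (a + b) = K + DB"
    using assms by (simp add: degree_add_eq_right a_def b_def)
  show ?thesis
  proof
    assume L: "split_test F A B K DA DB"
    then have lb: "l * b = h * a" using fin by simp
    \<comment> \<open>One division suffices: the identity \<open>l * b = h * a\<close> carries the
      quotient over to the other part after cancellation of a nonzero factor.\<close>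
    have "\<exists>q. l = a * q \<and> h = b * q"
    proof (cases "DA < DB")
      case True
      then obtain q where q: "l = a * q" using L fin by (auto elim: dvdE)
      then have "a * (b * q) = a * h" using lb by (simp add: algebra_simps)
      then show ?thesis using q ab0 by auto
    next
      case False
      then obtain q where q: "h = b * q" using L fin by (auto elim: dvdE)
      then have "b * (a * q) = b * l" using lb by (simp only: q ac_simps)
      then have "l = a * q" using ab0(2) by (metis mult_left_cancel)
      then show ?thesis using q by blast
    qed
    then obtain q where "l = a * q" "h = b * q" by blast
    then have "poly_of F = (a + b) * q" by (simp add: f algebra_simps)
    then show "poly_of A + poly_of B dvd poly_of F" by (simp add: a_def b_def)
  next
    assume "poly_of A + poly_of B dvd poly_of F"
    then obtain q where q: "poly_of F = (a + b) * q" by (auto elim: dvdE simp: a_def b_def)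
    \<comment> \<open>The gap enters here: the low product does not reach the exponent
      \<open>K\<close>, so \<open>a * q\<close> and \<open>b * q\<close> are separated there just as
      \<open>l\<close> and \<open>h\<close> are.\<close>
    have "degree (a * q) < K"
    proof (cases "q = 0")
      case False
      moreover have "a + b \<noteq> 0" using dab assms by auto
      ultimately have "degree (poly_of F) = K + DB + degree q"
        using dab by (simp add: q degree_mult_eq)
      then show ?thesis
        using degree_mult_le[of a q] assms by (simp add: a_def)
    qed (use assms in auto)
    then have 1: "coeff (a * q) i = 0" if "K \<le> i" for i
      using that by (simp add: coeff_eq_0)
    have 2: "coeff l i = 0" if "K \<le> i" for i
      using coeff_poly_of_filter_lt[OF that] by (simp add: l_def Fl_def)
    have 3: "monom 1 K dvd h"
      using monom_dvd_poly_of_filter by (simp add: h_def Fh_def)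
    have 4: "monom 1 K dvd b * q" using assms(3) by (simp add: b_def)
    have "l + h = a * q + b * q" using f q by (simp add: algebra_simps)
    from low_high_unique[OF this 2 1 3 4] have "l = a * q" "h = b * q" by simp_all
    then show "split_test F A B K DA DB" using fin by simp
  qed
qed

text \<open>By the last hypothesis \<open>2 ^ i\<close> times the gap exceeds the degree of a
  quotient. A round preserves this: \<open>F\<close> and \<open>G\<close> are multiplied by the same
  polynomial, of degree \<open>K + DB\<close>, and the doubled gap makes up for one power of
  2.\<close>

lemma gap_loop_correct:
  fixes F A B :: "(nat \<times> 'a::field) list"
  assumes "poly_of A \<noteq> 0" "poly_of B \<noteq> 0" "monom 1 K dvd poly_of B"
    "degree (poly_of A) = DA" "degree (poly_of B) = K + DB" "DA < K"
    "degree (poly_of F) + 2 ^ i * DA < 2 ^ i * K + (K + DB)"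
  shows "gap_loop i F A B K DA DB \<longleftrightarrow> poly_of A + poly_of B dvd poly_of F"
  using assms
proof (induction i arbitrary: F A B K DA DB)
  case 0
  then show ?case by (simp add: split_test_correct)
next
  case (Suc i)
  define a where "a = poly_of A"
  define b where "b = poly_of B"
  define F' where "F' = mul_terms F (mul_term 0 (- 1) B A)"
  define A' where "A' = mul_terms A A"
  define B' where "B' = mul_term 0 (- 1) (mul_terms B B) []"
  have F': "poly_of F' = poly_of F * (a - b)"
    by (simp add: F'_def a_def b_def monom_0_uminus_1)
  have A': "poly_of A' = a * a" by (simp add: A'_def a_def)
  have B': "poly_of B' = - (b * b)" by (simp add: B'_def b_def monom_0_uminus_1)
  have ab0: "a \<noteq> 0" "b \<noteq> 0" using Suc.prems by (simp_all add: a_def b_def)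
  \<comment> \<open>The low part does not affect the degree of \<open>a - b\<close>; hence this
    factor is nonzero and can be cancelled at the end.\<close>
  have dab: "degree (a - b) = K + DB"
    using Suc.prems degree_add_eq_right[of a "- b"] by (simp add: a_def b_def)
  then have ne: "a - b \<noteq> 0" using Suc.prems(6) by auto
  have "monom 1 K * monom 1 K dvd b * b"
    using Suc.prems(3) by (intro mult_dvd_mono) (simp_all add: b_def)
  then have m: "monom 1 (K + K) dvd poly_of B'"
    by (simp add: B' mult_monom)
  have "degree (poly_of F') \<le> degree (poly_of F) + (K + DB)"
    using degree_mult_le[of "poly_of F" "a - b"] dab by (simp add: F')
  then have deg: "degree (poly_of F') + 2 ^ i * (DA + DA) < 2 ^ i * (K + K) + (K + K + (DB + DB))"
    using Suc.prems(7) by (simp add: algebra_simps)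
  have "gap_loop (Suc i) F A B K DA DB \<longleftrightarrow> gap_loop i F' A' B' (K + K) (DA + DA) (DB + DB)"
    by (simp add: F'_def A'_def B'_def)
  also have "\<dots> \<longleftrightarrow> poly_of A' + poly_of B' dvd poly_of F'"
    using m deg Suc.prems(4-6) ab0
    by (intro Suc.IH) (auto simp: A' B' degree_mult_eq a_def[symmetric] b_def[symmetric])
  also have "poly_of A' + poly_of B' = (a + b) * (a - b)" by (simp add: A' B' algebra_simps)
  also have "(a + b) * (a - b) dvd poly_of F' \<longleftrightarrow> a + b dvd poly_of F"
    using ne by (simp add: F')
  finally show ?case by (simp add: a_def b_def)
qed

section \<open>Sparse term lists and the optimality of the chosen split\<close>

definition sparse_terms :: "(nat \<times> 'a::zero) list \<Rightarrow> bool" where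
  "sparse_terms L \<longleftrightarrow> distinct (map fst L) \<and> (\<forall>(e, a) \<in> set L. a \<noteq> 0)"

lemma sparse_terms_filter: "sparse_terms L \<Longrightarrow> sparse_terms (filter P L)"
  by (auto simp: sparse_terms_def distinct_map_filter)

text \<open>Distinct exponents exclude cancellation between terms.\<close>

lemma coeff_poly_of_nz:
  "sparse_terms L \<Longrightarrow> y \<in> set L \<Longrightarrow> coeff (poly_of L) (fst y) \<noteq> 0"
proof (induction L)
  case (Cons x L)
  show ?case
  proof (cases "y = x")
    case True
    then show ?thesis using Cons by (auto simp: sparse_terms_def coeff_poly_of_notin)
  next
    case False
    then have "y \<in> set L" using Cons by auto
    then have "fst y \<noteq> fst x" using Cons by (auto simp: sparse_terms_def)
    then show ?thesis using Cons False by (auto simp: sparse_terms_def)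
  qed
qed simp

lemma supp_poly_of: "sparse_terms L \<Longrightarrow> {i. coeff (poly_of L) i \<noteq> 0} = fst ` set L"
  using coeff_poly_of_nz[of L] coeff_poly_of_notin[of _ L] by blast

lemma max_exp_ge: "y \<in> set L \<Longrightarrow> fst y \<le> max_exp L"
  by (induction L) auto

lemma max_exp_in: "L \<noteq> [] \<Longrightarrow> max_exp L \<in> fst ` set L"
proof (induction L)
  case (Cons x L)
  then show ?case by (cases "L = []") (auto simp: max_def)
qed simp

lemma degree_poly_of:
  assumes "sparse_terms L"
  shows "degree (poly_of L) = max_exp L"
proof (cases "L = []")
  case False
  show ?thesis
  proof (rule antisym)
    show "degree (poly_of L) \<le> max_exp L"
      by (intro degree_le allI impI coeff_poly_of_notin) (use max_exp_ge[of _ L] in force)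
    show "max_exp L \<le> degree (poly_of L)"
      using max_exp_in[OF False] coeff_poly_of_nz[OF assms] by (auto intro!: le_degree)
  qed
qed simp

lemma poly_of_eq_0: "sparse_terms L \<Longrightarrow> poly_of L = 0 \<longleftrightarrow> L = []"
  using coeff_poly_of_nz[of L "hd L"] by (cases "L = []") auto

text \<open>The clauses are proved together because the candidate \<open>b\<close> changes along the
  list: the first one carries the comparison with earlier candidates through the induction.\<close>

lemma best_split_le:
  "score r (best_split r L b G n d) G n d \<le> score r b G n d \<and>
   (\<forall>y \<in> set L. score r (best_split r L b G n d) G n d \<le> score r (fst y) G n d) \<and>
   best_split r L b G n d \<in> insert b (fst ` set L)"
proof (induction L arbitrary: b)
  case (Cons x L)
  show ?case using Cons[of b] Cons[of "fst x"] by auto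
qed simp

section \<open>The divisibility test on sparse polynomials\<close>

text \<open>The given \<open>k\<close> need not be an exponent of \<open>G\<close>. Moving it up to
  the least exponent \<open>k'\<close> of the upper part keeps the low part, does not shrink the gap
  and does not raise the degree of the other factor. So \<open>k'\<close> takes part in the search
  with a score of at most both degrees, and \<open>K\<close> is at least as good.\<close>

lemma best_split_valid:
  fixes G :: "(nat \<times> 'a::field) list" and G0 G1 :: "'a poly" and r n k :: nat
  defines "K \<equiv> best_split r G (fst (hd G)) G n (max_exp G)"
  defines "A \<equiv> filter (\<lambda>y. fst y < K) G"
  assumes G: "sparse_terms G" and ne: "G0 \<noteq> 0" "G1 \<noteq> 0"
    and split: "poly_of G = G0 - monom 1 k * G1"
    and gap: "degree G0 < k" "n \<le> (k - degree G0) * 2 ^ r"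
  shows "G \<noteq> []" "K \<in> fst ` set G" "A \<noteq> []" "n \<le> (K - max_exp A) * 2 ^ r"
    "max_exp A \<le> degree G0 \<or> max_exp G - K \<le> degree G0"
    "max_exp A \<le> degree G1 \<or> max_exp G - K \<le> degree G1"
proof -
  define L where "L = filter (\<lambda>y. fst y < k) G"
  define H where "H = filter (\<lambda>y. \<not> fst y < k) G"
  have LH: "poly_of L + poly_of H = G0 + - (monom 1 k * G1)"
    using poly_of_filter_split[of "\<lambda>y. fst y < k" G] split by (simp add: L_def H_def)
  have 1: "coeff (poly_of L) i = 0" if "k \<le> i" for i
    using coeff_poly_of_filter_lt[OF that] by (simp add: L_def)
  have 2: "coeff G0 i = 0" if "k \<le> i" for i
    using gap(1) that by (simp add: coeff_eq_0)
  have 3: "monom 1 k dvd poly_of H" "monom 1 k dvd - (monom 1 k * G1)"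
    using monom_dvd_poly_of_filter by (auto simp: H_def)
  \<comment> \<open>Since \<open>degree G0 < k\<close>, cutting the terms of \<open>G\<close> at
    \<open>k\<close> recovers the two given summands.\<close>
  have L: "poly_of L = G0" and H: "poly_of H = - (monom 1 k * G1)"
    using low_high_unique[OF LH 1 2 3] by simp_all
  have sL: "sparse_terms L" using G sparse_terms_filter by (simp add: L_def)
  have L_ne: "L \<noteq> []" using L ne by auto
  have H_ne: "H \<noteq> []" using H ne by auto
  show G_ne: "G \<noteq> []" using L_ne by (auto simp: L_def)
  have mL: "max_exp L = degree G0" using degree_poly_of[OF sL] L by simp
  have dH: "degree (monom 1 k * G1) = k + degree G1"
    using ne by (simp add: degree_mult_eq degree_monom_eq)
  have mG: "max_exp G = k + degree G1"
    using degree_poly_of[OF G] split gap(1) dH degree_add_eq_right[of G0 "- (monom 1 k * G1)"]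
        by simp
  define k' where "k' = Min (fst ` set H)"
  have k'H: "k' \<in> fst ` set H" unfolding k'_def using H_ne by (intro Min_in) auto
  then have k': "k' \<in> fst ` set G" "k \<le> k'" by (auto simp: H_def)
  have "fst y < k' \<longleftrightarrow> fst y < k" if "y \<in> set G" for y
  proof -
    have "k' \<le> fst y" if "\<not> fst y < k"
      unfolding k'_def using \<open>y \<in> set G\<close> that by (intro Min_le) (auto simp: H_def)
    then show ?thesis using k'(2) by fastforce
  qed
  then have L': "filter (\<lambda>y. fst y < k') G = L"
    unfolding L_def by (intro filter_cong) auto
  have "(k - degree G0) * 2 ^ r \<le> (k' - degree G0) * 2 ^ r"
    using k'(2) by (intro mult_le_mono) auto
  then have gap': "\<not> (k' - degree G0) * 2 ^ r < n" using gap(2) by linarith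
  have "score r k' G n (max_exp G) = min (degree G0) (max_exp G - k')"
    using gap' L_ne by (simp add: score_def Let_def L' mL)
  also have "\<dots> \<le> min (degree G0) (degree G1)" using mG k'(2) by auto
  finally have sc: "score r K G n (max_exp G) \<le> min (degree G0) (degree G1)"
    using best_split_le[of r G "fst (hd G)" G n "max_exp G"] k'(1) unfolding K_def by fastforce
  show "K \<in> fst ` set G"
    using best_split_le[of r G "fst (hd G)" G n "max_exp G"] G_ne unfolding K_def by auto
  \<comment> \<open>A score of at most \<open>degree G0 < k\<close> is not the default
    \<open>max_exp G + 1\<close>, so \<open>K\<close> itself has a sufficient gap.\<close>
  have "score r K G n (max_exp G) \<noteq> max_exp G + 1" using sc gap(1) mG by auto
  then have v: "A \<noteq> []" "\<not> (K - max_exp A) * 2 ^ r < n"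
    and "score r K G n (max_exp G) = min (max_exp A) (max_exp G - K)"
    by (auto simp: score_def Let_def A_def split: if_splits)
  with sc show "A \<noteq> []" "n \<le> (K - max_exp A) * 2 ^ r"
    "max_exp A \<le> degree G0 \<or> max_exp G - K \<le> degree G0"
    "max_exp A \<le> degree G1 \<or> max_exp G - K \<le> degree G1"
    by (auto simp: min_def split: if_splits)
qed

lemma runs_prog:
  fixes F G :: "(nat \<times> 'a::field) list" and G0 G1 :: "'a poly"
  assumes F: "sparse_terms F" and G: "sparse_terms G" and ne: "G0 \<noteq> 0" "G1 \<noteq> 0"
    and split: "poly_of G = G0 - monom 1 k * G1"
    and gap: "degree G0 < k" "max_exp F + 1 - max_exp G \<le> (k - degree G0) * 2 ^ r"
    and x: "exps_lt x F" "exps_lt x G" "2 ^ Suc r * x \<le> 2 ^ W" and W: "2 \<le> W" "r < W" "W \<le> N"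
    and l: "length F \<le> l" "length G \<le> l" "length_bound r l \<le> N"
    and D: "2 ^ r * degree G0 \<le> N \<or> 2 ^ r * degree G1 \<le> N"
  shows "runs (prog r) W MAIN_FUN [encode_terms F, encode_terms G]
    (VNum (of_bool (poly_of G dvd poly_of F))) (4000 * (r + 1) * (N + 1) ^ 4)"
proof -
  define n where "n = max_exp F + 1 - max_exp G"
  define K where "K = best_split r G (fst (hd G)) G n (max_exp G)"
  define A where "A = filter (\<lambda>y. fst y < K) G"
  define B where "B = filter (\<lambda>y. \<not> fst y < K) G"
  note bs = best_split_valid[OF G ne split gap(1) gap(2), folded n_def, folded K_def, folded A_def]
  have sA: "sparse_terms A" and sB: "sparse_terms B"
    using G sparse_terms_filter by (auto simp: A_def B_def)
  have A0: "poly_of A \<noteq> 0" using bs(3) sA by (simp add: poly_of_eq_0)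
  have "B \<noteq> []" using bs(2) by (auto simp: B_def filter_empty_conv)
  then have B0: "poly_of B \<noteq> 0" using sB by (simp add: poly_of_eq_0)
  have dA: "degree (poly_of A) = max_exp A" by (rule degree_poly_of[OF sA])
  have KG: "K \<le> max_exp G" using bs(2) max_exp_ge by auto
  have AB: "poly_of A + poly_of B = poly_of G"
    using poly_of_filter_split[of "\<lambda>y. fst y < K" G] by (simp add: A_def B_def)
  have "max_exp A \<in> fst ` set A" using bs(3) by (rule max_exp_in)
  then have AK: "max_exp A < K" by (auto simp: A_def)
  have "poly_of B = - poly_of A + poly_of G" using AB by (simp add: algebra_simps)
  then have dB: "degree (poly_of B) = max_exp G"
    using degree_add_eq_right[of "- poly_of A" "poly_of G"] dA degree_poly_of[OF G] AK KG by simp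
  have D': "2 ^ r * min (max_exp A) (max_exp G - K) \<le> N"
  proof -
    have "min (max_exp A) (max_exp G - K) \<le> degree G0" "min (max_exp A) (max_exp G - K) \<le> degree G1"
      using bs(5,6) by auto
    then have "2 ^ r * min (max_exp A) (max_exp G - K) \<le> 2 ^ r * degree G0"
      "2 ^ r * min (max_exp A) (max_exp G - K) \<le> 2 ^ r * degree G1"
      by (auto intro: mult_le_mono)
    then show ?thesis using D by linarith
  qed
  have "monom 1 K dvd poly_of B" unfolding B_def by (rule monom_dvd_poly_of_filter)
  \<comment> \<open>By definition of \<open>n\<close> the degree of \<open>F\<close> is less than
    \<open>max_exp G + n\<close>, and \<open>n\<close> is at most \<open>2 ^ r\<close> times the gap
    at \<open>K\<close>.\<close>
  moreover have "degree (poly_of F) + 2 ^ r * max_exp A < 2 ^ r * K + (K + (max_exp G - K))"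
  proof -
    have "2 ^ r * max_exp A + (K - max_exp A) * 2 ^ r = 2 ^ r * K"
      using AK by (metis add_mult_distrib2 le_add_diff_inverse less_imp_le mult.commute)
    then show ?thesis
      using bs(4) KG degree_poly_of[OF F] unfolding n_def by linarith
  qed
  ultimately have "gap_loop r F A B K (max_exp A) (max_exp G - K)
      \<longleftrightarrow> poly_of A + poly_of B dvd poly_of F"
    using A0 B0 dA dB AK KG by (intro gap_loop_correct) auto
  then have "divides_test r F G \<longleftrightarrow> poly_of G dvd poly_of F"
    using AB by (simp add: divides_test_def Let_def A_def B_def K_def n_def)
  moreover have "runs (prog r) W MAIN_FUN [encode_terms F, encode_terms G]
    (VNum (of_bool (divides_test r F G))) (4000 * (r + 1) * (N + 1) ^ 4)"
    using runs_main[OF x(1,2) bs(1) x(3) W(1,2), folded n_def, folded K_def, folded A_def B_def,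
      OF KG dA A0 dB B0 l W(3) D'] .
  ultimately show ?thesis by simp
qed

text \<open>In terms of \<open>2 * l\<close> the recursion is squaring. As \<open>r\<close> is
  constant, \<open>length_bound r T\<close> is polynomial in \<open>T\<close>.\<close>

lemma two_length_bound: "2 * length_bound i l = (2 * l) ^ 2 ^ i"
proof (induction i arbitrary: l)
  case (Suc i)
  have "2 * length_bound (Suc i) l = (2 * (2 * l * l)) ^ 2 ^ i" by (simp add: Suc)
  also have "2 * (2 * l * l) = (2 * l)\<^sup>2" by (simp add: power2_eq_square)
  finally show ?case by (simp only: power_Suc flip: power_mult)
qed simp

text \<open>Absolute values account for negative coefficients of \<open>P\<close>; for
  \<open>s\<close> at least 1 every power is at most the top one.\<close>

lemma poly_le_power:
  fixes P :: "real poly"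
  assumes "1 \<le> s"
  shows "poly P s \<le> (\<Sum>i\<le>degree P. \<bar>coeff P i\<bar>) * s ^ degree P"
proof -
  have "poly P s = (\<Sum>i\<le>degree P. coeff P i * s ^ i)" by (rule poly_altdef)
  also have "\<dots> \<le> (\<Sum>i\<le>degree P. \<bar>coeff P i\<bar> * s ^ degree P)"
    using assms by (intro sum_mono mult_mono power_increasing) auto
  finally show ?thesis by (simp add: sum_distrib_right)
qed

section \<open>From sparse representations to term lists\<close>

lemma sparse_rep_iff: "sparse_rep L p \<longleftrightarrow> sparse_terms L \<and> p = poly_of L"
  by (simp add: sparse_rep_def sparse_terms_def poly_of_def)

lemma sparsity_poly_of: "sparse_terms L \<Longrightarrow> sparsity (poly_of L) = length L"
  unfolding sparsity_def supp_poly_of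
  by (simp add: sparse_terms_def card_image distinct_map distinct_card)

lemma exps_ltI: "max_exp L < x \<Longrightarrow> exps_lt x L"
  using max_exp_ge[of _ L] unfolding exps_lt_def by fastforce

text \<open>The program depends on \<open>c\<close> alone, through \<open>r\<close>;
  \<open>P\<close> enters only the constants of the cost bound. All size parameters of
  \<open>runs_prog\<close> are bounded by multiples of one power of the input size.\<close>

theorem theorem3p8:
  fixes c :: real and P :: "real poly"
  assumes "c > 0"
  shows "\<exists>(prog :: program) (C :: real) (d :: nat).
    \<forall>(F :: 'a::field poly) (G :: 'a poly) (m :: nat) (n :: nat) (T :: nat) fs gs.
      n \<ge> 1 \<and> F \<noteq> 0 \<and> G \<noteq> 0 \<and> degree F = m + n - 1 \<and> degree G = m \<and>
      sparsity F \<le> T \<and> sparsity G \<le> T \<and> sparse_rep fs F \<and> sparse_rep gs G \<and>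
      (\<exists>k G0 G1. G0 \<noteq> 0 \<and> G1 \<noteq> 0 \<and> G = G0 - monom 1 k * G1 \<and>
         real k - real (degree G0) \<ge> c * real n \<and>
         (real (degree G0) \<le> poly P (input_size T m n) \<or>
          real (degree G1) \<le> poly P (input_size T m n)))
      \<longrightarrow> (\<exists>t. run prog [encode_terms fs, encode_terms gs] t (VNum (of_bool (G dvd F))) \<and>
               real t \<le> C * input_size T m n ^ d)"
proof -
  \<comment> \<open>After \<open>r\<close> doublings a gap of \<open>c * n\<close> is at least
    \<open>n\<close>, which exceeds the degree \<open>n - 1\<close> of a nonzero quotient.\<close>
  obtain r :: nat where "1 / c < 2 ^ r" using real_arch_pow[of 2 "1 / c"] by auto
  then have r: "1 \<le> c * 2 ^ r" using assms by (simp add: field_simps)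
  define Q where "Q = (\<Sum>i\<le>degree P. \<bar>coeff P i\<bar>)"
  have Q: "0 \<le> Q" by (simp add: Q_def sum_nonneg)
  \<comment> \<open>The exponent dominates the growth \<open>2 ^ r\<close> of the lists, the degree
    of \<open>P\<close> and the linear growth of \<open>W\<close>; \<open>E\<close> adds up the
    corresponding factors.\<close>
  define d where "d = 2 ^ r + degree P + 1"
  define E where "E = 2 ^ 2 ^ r + (real r + 3) + 2 ^ r * Q + 1"
  show ?thesis
  proof (rule exI[of _ "prog r"], rule exI[of _ "4000 * (real r + 1) * E ^ 6"],
      rule exI[of _ "d * 6"],
      intro allI impI, elim conjE exE)
    fix F G :: "'a poly" and m n T :: nat and fs gs :: "(nat \<times> 'a) list"
        and k :: nat and G0 G1 :: "'a poly"
    assume n: "1 \<le> n" and F: "F \<noteq> 0" "degree F = m + n - 1" and G: "G \<noteq> 0" "degree G = m"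
      and T: "sparsity F \<le> T" "sparsity G \<le> T" and rep: "sparse_rep fs F" "sparse_rep gs G"
      and ne: "G0 \<noteq> 0" "G1 \<noteq> 0" and split: "G = G0 - monom 1 k * G1"
      and gap: "c * real n \<le> real k - real (degree G0)"
      and D: "real (degree G0) \<le> poly P (input_size T m n) \<or> real (degree G1) \<le> poly P
          (input_size T m n)"
    define S where "S = input_size T m n"
    have fs: "sparse_terms fs" "F = poly_of fs" and gs: "sparse_terms gs" "G = poly_of gs"
      using rep by (auto simp: sparse_rep_iff)
    have len: "length fs \<le> T" "length gs \<le> T" using T fs gs by (simp_all add: sparsity_poly_of)
    have me: "max_exp fs = m + n - 1" "max_exp gs = m"
      using F G fs gs degree_poly_of by metis+
    have "0 < c * real n" using assms n by simp
    then have k: "degree G0 < k" using gap by linarith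
    have "degree (monom 1 k * G1) = k + degree G1"
      using ne by (simp add: degree_mult_eq degree_monom_eq)
    then have "m = k + degree G1"
      using split G k degree_add_eq_right[of G0 "- (monom 1 k * G1)"] by simp
    then have m: "1 \<le> m" using k by simp
    have T1: "1 \<le> T" using len(1) fs F by (cases fs) auto
    \<comment> \<open>As \<open>m + n\<close> is at least 2 and \<open>T\<close> at least 1, the
      input size is at least 1, so its powers increase with the exponent.\<close>
    have lg: "1 \<le> log 2 (real (m + n))" using m n by (simp add: le_log_iff)
    have ST: "real T \<le> S" using mult_left_mono[OF lg, of "real T"]
        by (simp add: S_def input_size_def)
    have Slog: "log 2 (real (m + n)) \<le> S"
      using mult_right_mono[of 1 "real T" "log 2 (real (m + n))"] T1 lg
          by (simp add: S_def input_size_def)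
    have S1: "1 \<le> S" using lg Slog by linarith
    \<comment> \<open>Enough digits for exponents below \<open>m + n\<close>, for \<open>r\<close>
      doublings and for the products of the final test.\<close>
    define W where "W = r + 1 + floorlog 2 (m + n)"
    have fl: "floorlog 2 (m + n) = nat \<lfloor>log 2 (real (m + n))\<rfloor> + 1"
      using m by (simp add: floorlog_def)
    then have "real (floorlog 2 (m + n)) \<le> log 2 (real (m + n)) + 1" using lg by simp
    then have W_le: "real W \<le> (real r + 3) * S"
      using Slog S1 mult_left_mono[OF S1, of "real r + 2"] by (simp add: W_def algebra_simps)
    have W: "2 \<le> W" "r < W" using fl by (auto simp: W_def)
    have "m + n < 2 ^ floorlog 2 (m + n)" using floorlog_le_iff[of 2 "m + n" "floorlog 2 (m + n)"]
        by simp
    then have x: "2 ^ Suc r * (m + n) \<le> 2 ^ W" by (simp add: W_def power_add)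
    have xs: "exps_lt (m + n) fs" "exps_lt (m + n) gs"
      using me n by (auto intro!: exps_ltI)
    have gap': "max_exp fs + 1 - max_exp gs \<le> (k - degree G0) * 2 ^ r"
    proof -
      have "real n * 1 \<le> real n * (c * 2 ^ r)" using r by (intro mult_left_mono) auto
      also have "\<dots> = (c * real n) * 2 ^ r" by simp
      also have "\<dots> \<le> (real k - real (degree G0)) * 2 ^ r" using gap by (intro mult_right_mono) auto
      also have "\<dots> = real ((k - degree G0) * 2 ^ r)" using k by (simp add: of_nat_diff)
      finally have "n \<le> (k - degree G0) * 2 ^ r" by (simp only: of_nat_le_iff mult_1_right)
      then show ?thesis using me n by simp
    qed
    \<comment> \<open>Only the smaller degree matters: it is at most whichever of the two is bounded
      in terms of \<open>P\<close>.\<close>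
    define D where "D = min (degree G0) (degree G1)"
    define N where "N = length_bound r T + W + 2 ^ r * D"
    have "runs (prog r) W MAIN_FUN [encode_terms fs, encode_terms gs]
      (VNum (of_bool (G dvd F))) (4000 * (r + 1) * (N + 1) ^ 4)"
      unfolding fs(2) gs(2)
      by (rule runs_prog[OF fs(1) gs(1) ne split[unfolded gs(2)] k gap' xs x W _ len])
        (auto simp: N_def D_def min_def)
    from runs_run[OF this] obtain t where t: "run (prog r) [encode_terms fs, encode_terms gs] t
        (VNum (of_bool (G dvd F)))"
      "t \<le> 4000 * (r + 1) * (N + 1) ^ 4 * op_cost W" by blast
    \<comment> \<open>The cost unit contributes two more factors \<open>N + 1\<close>, hence the
      sixth power.\<close>
    have "op_cost W \<le> (N + 1)\<^sup>2" by (auto simp: op_cost_def N_def intro: power_mono)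
    then have "4000 * (r + 1) * (N + 1) ^ 4 * op_cost W \<le> 4000 * (r + 1) * (N + 1) ^ 4 * (N + 1)\<^sup>2"
      by (rule mult_le_mono2)
    with t(2) have "t \<le> 4000 * (r + 1) * (N + 1) ^ 4 * (N + 1)\<^sup>2" by (rule le_trans)
    also have "\<dots> = 4000 * (r + 1) * (N + 1) ^ 6"
      by (simp only: mult.assoc flip: power_add) simp
    finally have tN: "real t \<le> 4000 * (real r + 1) * (real N + 1) ^ 6"
      by (metis (mono_tags, opaque_lifting) of_nat_le_iff of_nat_mult of_nat_power of_nat_add
          of_nat_1 of_nat_numeral)
    have pw: "S ^ i \<le> S ^ d" if "i \<le> d" for i using that S1 by (rule power_increasing)
    have "length_bound r T \<le> (2 * T) ^ 2 ^ r" using two_length_bound[of r T] by linarith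
    then have "real (length_bound r T) \<le> real ((2 * T) ^ 2 ^ r)" by (simp only: of_nat_le_iff)
    also have "\<dots> = 2 ^ 2 ^ r * real T ^ 2 ^ r" by (simp add: power_mult_distrib)
    also have "\<dots> \<le> 2 ^ 2 ^ r * S ^ 2 ^ r" using ST by (intro mult_left_mono power_mono) auto
    also have "\<dots> \<le> 2 ^ 2 ^ r * S ^ d" by (intro mult_left_mono pw) (auto simp: d_def)
    finally have 1: "real (length_bound r T) \<le> 2 ^ 2 ^ r * S ^ d" .
    have "S \<le> S ^ d" using pw[of 1] by (simp add: d_def)
    then have "(real r + 3) * S \<le> (real r + 3) * S ^ d" by (intro mult_left_mono) auto
    then have 2: "real W \<le> (real r + 3) * S ^ d" using W_le by linarith
    have "real D \<le> poly P S" using D by (auto simp: D_def S_def)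
    also have "\<dots> \<le> Q * S ^ degree P" unfolding Q_def by (rule poly_le_power[OF S1])
    also have "\<dots> \<le> Q * S ^ d" using Q by (intro mult_left_mono pw) (auto simp: d_def)
    finally have "2 ^ r * real D \<le> 2 ^ r * (Q * S ^ d)" by (intro mult_left_mono) auto
    then have 3: "real (2 ^ r * D) \<le> 2 ^ r * Q * S ^ d" by (simp add: mult.assoc)
    have 4: "1 \<le> S ^ d" using S1 by (rule one_le_power)
    have "real N + 1 = real (length_bound r T) + real W + real (2 ^ r * D) + 1" by (simp add: N_def)
    also have "\<dots> \<le> 2 ^ 2 ^ r * S ^ d + (real r + 3) * S ^ d + 2 ^ r * Q * S ^ d + S ^ d"
      by (intro add_mono 1 2 3 4)
    also have "\<dots> = E * S ^ d" by (simp add: E_def algebra_simps)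
    finally have "real N + 1 \<le> E * S ^ d" .
    then have "(real N + 1) ^ 6 \<le> (E * S ^ d) ^ 6" by (intro power_mono) auto
    also have "\<dots> = E ^ 6 * S ^ (d * 6)" by (simp add: power_mult_distrib power_mult)
    finally have "4000 * (real r + 1) * (real N + 1) ^ 6 \<le> 4000 * (real r + 1) * (E ^ 6 * S ^
        (d * 6))"
      by (intro mult_left_mono) auto
    with tN have "real t \<le> 4000 * (real r + 1) * (E ^ 6 * S ^ (d * 6))" by (rule order_trans)
    then have "real t \<le> 4000 * (real r + 1) * E ^ 6 * S ^ (d * 6)" by (simp only: mult.assoc)
    with t(1) show "\<exists>t. run (prog r) [encode_terms fs, encode_terms gs] t (VNum (of_bool
        (G dvd F))) \<and>
        real t \<le> 4000 * (real r + 1) * E ^ 6 * input_size T m n ^ (d * 6)"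
      by (auto simp: S_def)
  qed
qed

end
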